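(* Let $F$ be a free group of finite rank with fixed basis $A$ and let $H$ be a non-trivial finitely generated subgroup of $F$. The malnormal closure $H_{\mathsf{mal}}$ of $H$ is computed by repeatedly applying the following construction: in $\Gamma(H)$, identify all pairs $(p,q)$ of distinct vertices in $\mathsf{cc}(\Gamma(H))$ such that $L_p(H)\cap L_q(H)$ is infinite, and reduce the resulting graph. That is, if $H_0=H$ and, for each $i\ge 0$, $H_{i+1}$ is the subgroup of $F$ such that $\mathcal{A}(H_{i+1})$ is obtained by applying this construction to $\mathcal{A}(H_i)$, then there is $k\ge 0$ such that $\mathsf{cc}(\Gamma(H_k))$ has no pair of distinct vertices $p,q$ with $L_p(H_k)\cap L_q(H_k)$ infinite (so that the sequence is constant from $H_k$ on), and $H_k=H_{\mathsf{mal}}$.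
   Context: Words: $F$ is a free group with finite basis $A$; $\bar A=\{\bar a: a\in A\}$ is a disjoint copy of $A$ and $\tilde A=A\cup\bar A$, with $\bar{\bar a}=a$. Elements of $F$ are identified with reduced words over $\tilde A$ (no factor $a\bar a$, $a\in\tilde A$). Stallings graph: each finitely generated $H\le F$ has a unique representation $\mathcal{A}(H)=(\Gamma(H),1)$, where $\Gamma(H)$ is a finite connected directed graph with edges labeled by $A$ and $1$ is a designated vertex, such that (i) for each $a\in A$ every vertex is the source of at most one and the target of at most one $a$-labeled edge; (ii) every vertex except possibly $1$ has degree (in-degree plus out-degree) at least $2$; (iii) a reduced word is in $H$ iff it labels a loop at $1$. Conversely every pair $(\Gamma,1)$ with $\Gamma$ finite and connected satisfying (i) and (ii) represents a unique finitely generated subgroup. Here an edge $(p,a,q)$, $a\in A$, is read as $p\xrightarrow{a}q$ and $q\xrightarrow{\bar a}p$. Reducing a graph means repeatedly identifying vertices $p,p'$ such that $q\xrightarrow{a}p$ and $q\xrightarrow{a}p'$ for some vertex $q$ and $a\in\tilde A$. Core: for $H$ non-trivial, if every vertex of $\Gamma(H)$ has degree at least $2$, then $\mathsf{cc}(\Gamma(H))=\Gamma(H)$. Otherwise vertex $1$ has degree $1$; the tail consists of $1$ and all degree-$2$ vertices that can be connected to $1$ through other degree-$2$ vertices, and the core $\mathsf{cc}(\Gamma(H))$ is the rest of $\Gamma(H)$. Languages: for a vertex $p$ of $\mathsf{cc}(\Gamma(H))$, $L_p(H)$ is the set of reduced words over $\tilde A$ labeling a path in $\mathsf{cc}(\Gamma(H))$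 starting at $p$. Malnormality: a subgroup $K$ of $F$ is malnormal if $K^g\cap K=1$ for each $g\in F\setminus K$, where $K^g=g^{-1}Kg$. It is known that every finitely generated $H\le F$ has a least malnormal extension (the smallest malnormal subgroup of $F$ containing $H$), called its malnormal closure $H_{\mathsf{mal}}$, and that $H_{\mathsf{mal}}$ is finitely generated. *)

theory Defs
  imports "HOL-Algebra.Generated_Groups"
begin

section \<open>The free group as the group of reduced words\<close>

text \<open>\<open>Neg a\<close> is the formal inverse of the basis element \<open>a\<close>.\<close>

datatype 'a letter = Pos 'a | Neg 'a

type_synonym 'a word = "'a letter list"

fun bar :: "'a letter \<Rightarrow> 'a letter" where
  "bar (Pos a) = Neg a"
| "bar (Neg a) = Pos a"

definition letters :: "'a set \<Rightarrow> 'a letter set" where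
  "letters A = Pos ` A \<union> Neg ` A"

definition reduced :: "'a word \<Rightarrow> bool" where
  "reduced w \<longleftrightarrow> successively (\<lambda>x y. y \<noteq> bar x) w"

text \<open>\<open>reduce w\<close> is the reduced word equivalent to \<open>w\<close>.\<close>

fun cancel :: "'a letter \<Rightarrow> 'a word \<Rightarrow> 'a word" where
  "cancel x [] = [x]"
| "cancel x (y # w) = (if y = bar x then w else x # y # w)"

definition reduce :: "'a word \<Rightarrow> 'a word" where
  "reduce w = foldr cancel w []"

definition free_group :: "'a set \<Rightarrow> 'a word monoid" where
  "free_group A =
     \<lparr>carrier = {w. reduced w \<and> set w \<subseteq> letters A},
      monoid.mult = (\<lambda>u v. reduce (u @ v)),
      one = []\<rparr>"

lemma bar_bar [simp]: "bar (bar x) = x"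
  by (cases x) auto

lemma bar_neq [simp]: "bar x \<noteq> x" "x \<noteq> bar x"
  by (cases x; simp)+

lemma reduced_Nil [simp]: "reduced []"
  by (simp add: reduced_def)

lemma reduced_ConsD: "reduced (x # w) \<Longrightarrow> reduced w"
  by (cases w) (auto simp: reduced_def)

lemma reduced_cancel: "reduced w \<Longrightarrow> reduced (cancel x w)"
  by (cases w) (auto simp: reduced_def dest: reduced_ConsD[unfolded reduced_def])

lemma cancel_reduced: "reduced (x # w) \<Longrightarrow> cancel x w = x # w"
  by (cases w) (auto simp: reduced_def)

lemma cancel_cancel: "reduced w \<Longrightarrow> cancel (bar x) (cancel x w) = w"
  by (cases w) (auto simp: cancel_reduced)

lemma reduced_foldr_cancel: "reduced v \<Longrightarrow> reduced (foldr cancel u v)"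
  by (induction u) (auto simp: reduced_cancel)

lemma reduce_reduced: "reduced w \<Longrightarrow> reduce w = w"
proof (induction w)
  case (Cons x w)
  then show ?case
    using reduced_ConsD[OF Cons.prems] cancel_reduced[OF Cons.prems] by (simp add: reduce_def)
qed (simp add: reduce_def)

lemma foldr_cancel_cancel:
  "reduced v \<Longrightarrow> foldr cancel (cancel x u) v = cancel x (foldr cancel u v)"
proof (cases u)
  case (Cons y w)
  assume "reduced v"
  then have "cancel (bar (bar x)) (cancel (bar x) (foldr cancel w v)) = foldr cancel w v"
    by (intro cancel_cancel reduced_foldr_cancel)
  then show ?thesis using Cons by simp
qed simp

lemma foldr_cancel_foldr:
  "reduced v \<Longrightarrow> foldr cancel (foldr cancel u w) v = foldr cancel u (foldr cancel w v)"
  by (induction u) (auto simp: foldr_cancel_cancel)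

lemma set_foldr_cancel: "set (foldr cancel u v) \<subseteq> set u \<union> set v"
proof (induction u)
  case (Cons x u)
  have "set (cancel x w) \<subseteq> insert x (set w)" for w :: "'a word"
    by (cases w) auto
  with Cons show ?case by fastforce
qed simp

lemma foldr_cancel_inverse: "reduced v \<Longrightarrow> foldr cancel (rev (map bar u)) (foldr cancel u v) = v"
  by (induction u arbitrary: v) (auto simp: cancel_cancel reduced_foldr_cancel)

lemma bar_mem_letters: "x \<in> letters A \<Longrightarrow> bar x \<in> letters A"
  by (auto simp: letters_def)

theorem group_free_group: "group (free_group A)"
proof (rule groupI)
  fix u v assume "u \<in> carrier (free_group A)" "v \<in> carrier (free_group A)"
  then show "u \<otimes>\<^bsub>free_group A\<^esub> v \<in> carrier (free_group A)"
    using set_foldr_cancel[of "u @ v" "[]"]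
    by (auto simp: free_group_def reduce_def reduced_foldr_cancel simp del: foldr_append)
next
  fix u v w
  assume "u \<in> carrier (free_group A)" "v \<in> carrier (free_group A)" "w \<in> carrier (free_group A)"
  then show "u \<otimes>\<^bsub>free_group A\<^esub> v \<otimes>\<^bsub>free_group A\<^esub> w =
      u \<otimes>\<^bsub>free_group A\<^esub> (v \<otimes>\<^bsub>free_group A\<^esub> w)"
    using foldr_cancel_foldr[of "[]"]
    by (simp add: free_group_def reduce_def foldr_cancel_foldr reduced_foldr_cancel)
next
  fix u assume u: "u \<in> carrier (free_group A)"
  define v where "v = reduce (rev (map bar u))"
  have "v \<in> carrier (free_group A)"
    using u set_foldr_cancel[of "rev (map bar u)" "[]"] bar_mem_letters[of _ A]
    by (auto simp: v_def free_group_def reduce_def reduced_foldr_cancel)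
  moreover have "v \<otimes>\<^bsub>free_group A\<^esub> u = \<one>\<^bsub>free_group A\<^esub>"
    using foldr_cancel_inverse[of "[]" u]
    by (simp add: v_def free_group_def reduce_def foldr_cancel_foldr reduced_foldr_cancel)
  ultimately show "\<exists>v\<in>carrier (free_group A). v \<otimes>\<^bsub>free_group A\<^esub> u = \<one>\<^bsub>free_group A\<^esub>"
    by blast
qed (auto simp: free_group_def reduce_reduced)


section \<open>Malnormal subgroups and the malnormal closure\<close>

definition finitely_generated :: "('g, 'b) monoid_scheme \<Rightarrow> 'g set \<Rightarrow> bool" where
  "finitely_generated G H \<longleftrightarrow> (\<exists>S \<subseteq> carrier G. finite S \<and> H = generate G S)"

definition conjugate :: "('g, 'b) monoid_scheme \<Rightarrow> 'g set \<Rightarrow> 'g \<Rightarrow> 'g set" where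
  "conjugate G K g = (\<lambda>k. inv\<^bsub>G\<^esub> g \<otimes>\<^bsub>G\<^esub> k \<otimes>\<^bsub>G\<^esub> g) ` K"

definition malnormal :: "('g, 'b) monoid_scheme \<Rightarrow> 'g set \<Rightarrow> bool" where
  "malnormal G K \<longleftrightarrow>
     subgroup K G \<and> (\<forall>g \<in> carrier G - K. conjugate G K g \<inter> K = {\<one>\<^bsub>G\<^esub>})"

text \<open>\<open>K\<close> is the least malnormal subgroup of \<open>G\<close> containing \<open>H\<close>; this determines \<open>K\<close>.\<close>

definition is_malnormal_closure :: "('g, 'b) monoid_scheme \<Rightarrow> 'g set \<Rightarrow> 'g set \<Rightarrow> bool" where
  "is_malnormal_closure G H K \<longleftrightarrow>
     malnormal G K \<and> H \<subseteq> K \<and> (\<forall>K'. malnormal G K' \<and> H \<subseteq> K' \<longrightarrow> K \<subseteq> K')"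


section \<open>Labeled graphs and Stallings graphs\<close>

record ('v, 'a) lgraph =
  verts :: "'v set"
  edges :: "('v \<times> 'a \<times> 'v) set"

text \<open>An edge \<open>(p, a, q)\<close> is read as \<open>a\<close> from \<open>p\<close> to \<open>q\<close> and as the inverse of \<open>a\<close> from
  \<open>q\<close> to \<open>p\<close>; \<open>path \<Gamma> p w q\<close> means that \<open>w\<close> labels a path from \<open>p\<close> to \<open>q\<close>.\<close>

fun step :: "('v, 'a) lgraph \<Rightarrow> 'v \<Rightarrow> 'a letter \<Rightarrow> 'v \<Rightarrow> bool" where
  "step \<Gamma> p (Pos a) q \<longleftrightarrow> (p, a, q) \<in> edges \<Gamma>"
| "step \<Gamma> p (Neg a) q \<longleftrightarrow> (q, a, p) \<in> edges \<Gamma>"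

fun path :: "('v, 'a) lgraph \<Rightarrow> 'v \<Rightarrow> 'a word \<Rightarrow> 'v \<Rightarrow> bool" where
  "path \<Gamma> p [] q \<longleftrightarrow> p \<in> verts \<Gamma> \<and> p = q"
| "path \<Gamma> p (x # w) q \<longleftrightarrow> (\<exists>r. step \<Gamma> p x r \<and> path \<Gamma> r w q)"

definition degree :: "('v, 'a) lgraph \<Rightarrow> 'v \<Rightarrow> nat" where
  "degree \<Gamma> p = card {(r, a, q) \<in> edges \<Gamma>. q = p} + card {(r, a, q) \<in> edges \<Gamma>. r = p}"

definition finite_connected_graph :: "'a set \<Rightarrow> ('v, 'a) lgraph \<Rightarrow> bool" where
  "finite_connected_graph A \<Gamma> \<longleftrightarrow>
     finite (verts \<Gamma>) \<and> finite (edges \<Gamma>) \<and> edges \<Gamma> \<subseteq> verts \<Gamma> \<times> A \<times> verts \<Gamma> \<and>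
     (\<forall>p \<in> verts \<Gamma>. \<forall>q \<in> verts \<Gamma>. \<exists>w. path \<Gamma> p w q)"

text \<open>\<open>stallings A \<Gamma> b H\<close>: the graph \<open>\<Gamma>\<close> with designated vertex \<open>b\<close> is the Stallings graph of
  \<open>H\<close>, which is unique up to isomorphism.\<close>

definition stallings :: "'a set \<Rightarrow> ('v, 'a) lgraph \<Rightarrow> 'v \<Rightarrow> 'a word set \<Rightarrow> bool" where
  "stallings A \<Gamma> b H \<longleftrightarrow>
     finite_connected_graph A \<Gamma> \<and> b \<in> verts \<Gamma> \<and>
     (\<forall>p a q q'. (p, a, q) \<in> edges \<Gamma> \<and> (p, a, q') \<in> edges \<Gamma> \<longrightarrow> q = q') \<and>
     (\<forall>p p' a q. (p, a, q) \<in> edges \<Gamma> \<and> (p', a, q) \<in> edges \<Gamma> \<longrightarrow> p = p') \<and>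
     (\<forall>p \<in> verts \<Gamma> - {b}. degree \<Gamma> p \<ge> 2) \<and>
     H = {w \<in> carrier (free_group A). path \<Gamma> b w b}"


section \<open>The core and its languages\<close>

definition adjacent :: "('v, 'a) lgraph \<Rightarrow> 'v \<Rightarrow> 'v \<Rightarrow> bool" where
  "adjacent \<Gamma> p q \<longleftrightarrow> (\<exists>x. step \<Gamma> p x q)"

inductive_set tail :: "('v, 'a) lgraph \<Rightarrow> 'v \<Rightarrow> 'v set" for \<Gamma> b where
  base: "b \<in> tail \<Gamma> b"
| step: "\<lbrakk>p \<in> tail \<Gamma> b; adjacent \<Gamma> p q; degree \<Gamma> q = 2\<rbrakk> \<Longrightarrow> q \<in> tail \<Gamma> b"

text \<open>Meant for Stallings graphs of non-trivial subgroups: if some vertex has degree less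
  than 2, then it is \<open>b\<close> and has degree 1.\<close>

definition core :: "('v, 'a) lgraph \<Rightarrow> 'v \<Rightarrow> ('v, 'a) lgraph" where
  "core \<Gamma> b =
     (if \<forall>p \<in> verts \<Gamma>. degree \<Gamma> p \<ge> 2 then \<Gamma>
      else \<lparr>verts = verts \<Gamma> - tail \<Gamma> b,
            edges = {(p, a, q) \<in> edges \<Gamma>. p \<notin> tail \<Gamma> b \<and> q \<notin> tail \<Gamma> b}\<rparr>)"

definition core_language :: "('v, 'a) lgraph \<Rightarrow> 'v \<Rightarrow> 'v \<Rightarrow> 'a word set" where
  "core_language \<Gamma> b p = {w. reduced w \<and> (\<exists>q. path (core \<Gamma> b) p w q)}"

definition infinite_pairs :: "('v, 'a) lgraph \<Rightarrow> 'v \<Rightarrow> ('v \<times> 'v) set" where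
  "infinite_pairs \<Gamma> b =
     {(p, q). p \<in> verts (core \<Gamma> b) \<and> q \<in> verts (core \<Gamma> b) \<and> p \<noteq> q \<and>
        infinite (core_language \<Gamma> b p \<inter> core_language \<Gamma> b q)}"


section \<open>Identifying vertices and reducing\<close>

definition map_lgraph :: "('v \<Rightarrow> 'w) \<Rightarrow> ('v, 'a) lgraph \<Rightarrow> ('w, 'a) lgraph" where
  "map_lgraph f \<Gamma> =
     \<lparr>verts = f ` verts \<Gamma>, edges = (\<lambda>(p, a, q). (f p, a, f q)) ` edges \<Gamma>\<rparr>"

text \<open>\<open>identifies R \<Gamma> b \<Gamma>' b'\<close>: up to renaming vertices, \<open>(\<Gamma>', b')\<close> is the quotient of \<open>(\<Gamma>, b)\<close>
  by the equivalence relation generated by \<open>R\<close>. The renaming keeps all the graphs of an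
  iterated construction over one vertex type.\<close>

definition identifies ::
  "('v \<times> 'v) set \<Rightarrow> ('v, 'a) lgraph \<Rightarrow> 'v \<Rightarrow> ('v, 'a) lgraph \<Rightarrow> 'v \<Rightarrow> bool" where
  "identifies R \<Gamma> b \<Gamma>' b' \<longleftrightarrow>
     (\<exists>f. (\<forall>p \<in> verts \<Gamma>. \<forall>q \<in> verts \<Gamma>. f p = f q \<longleftrightarrow> (p, q) \<in> (R \<union> R\<inverse>)\<^sup>*) \<and>
          \<Gamma>' = map_lgraph f \<Gamma> \<and> b' = f b)"

definition foldable :: "('v, 'a) lgraph \<Rightarrow> 'v \<Rightarrow> 'v \<Rightarrow> bool" where
  "foldable \<Gamma> p p' \<longleftrightarrow> p \<noteq> p' \<and> (\<exists>q x. step \<Gamma> q x p \<and> step \<Gamma> q x p')"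

inductive reduces_to ::
  "('v, 'a) lgraph \<Rightarrow> 'v \<Rightarrow> ('v, 'a) lgraph \<Rightarrow> 'v \<Rightarrow> bool" where
  stop: "(\<And>p p'. \<not> foldable \<Gamma> p p') \<Longrightarrow> reduces_to \<Gamma> b \<Gamma> b"
| fold: "\<lbrakk>foldable \<Gamma> p p'; identifies {(p, p')} \<Gamma> b \<Gamma>' b'; reduces_to \<Gamma>' b' \<Gamma>'' b''\<rbrakk>
         \<Longrightarrow> reduces_to \<Gamma> b \<Gamma>'' b''"

definition construction ::
  "('v, 'a) lgraph \<Rightarrow> 'v \<Rightarrow> ('v, 'a) lgraph \<Rightarrow> 'v \<Rightarrow> bool" where
  "construction \<Gamma> b \<Gamma>' b' \<longleftrightarrow>
     (\<exists>\<Delta> d. identifies (infinite_pairs \<Gamma> b) \<Gamma> b \<Delta> d \<and> reduces_to \<Delta> d \<Gamma>' b')"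

text \<open>The subgroups \<open>Hs i\<close> obtained from \<open>H\<close> by iterating the construction, together with their
  Stallings graphs \<open>(\<Gamma> i, b i)\<close>. The vertices are natural numbers, which is no restriction
  for finite graphs.\<close>

definition construction_sequence ::
  "'a set \<Rightarrow> 'a word set \<Rightarrow> (nat \<Rightarrow> 'a word set) \<Rightarrow> (nat \<Rightarrow> (nat, 'a) lgraph) \<Rightarrow> (nat \<Rightarrow> nat) \<Rightarrow> bool"
where
  "construction_sequence A H Hs \<Gamma> b \<longleftrightarrow>
     Hs 0 = H \<and>
     (\<forall>i. stallings A (\<Gamma> i) (b i) (Hs i)) \<and>
     (\<forall>i. construction (\<Gamma> i) (b i) (\<Gamma> (Suc i)) (b (Suc i)))"

end

theory Submission
  imports Defs
begin

text \<open>
  If a malnormal subgroup \<open>K\<close> contains the current subgroup, then the graph maps to the Schreier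
  graph of \<open>K\<close>. If \<open>L\<^sub>p \<inter> L\<^sub>q\<close> is infinite, a long common word passes through two
  vertices carrying loops with the same label, and malnormality forces these vertices, hence also
  \<open>p\<close> and \<open>q\<close>, to have the same image. So the map factors through the identification and the
  foldings, and the next subgroup is still contained in \<open>K\<close>.

  If the final subgroup \<open>K\<close> were not malnormal, some \<open>1 \<noteq> s c s\<^sup>-\<^sup>1 \<in> K\<close> with \<open>c\<close> cyclically
  reduced would be conjugate into \<open>K\<close> by an element outside \<open>K\<close>. Then \<open>c\<close> labels loops at two
  distinct vertices of the Schreier graph; both loops lie in the core, so the powers of \<open>c\<close> are
  common to the languages of these vertices. Termination: each identification lowers the number
  of vertices.
\<close>

section \<open>Words\<close>

abbreviation inv_word :: "'a word \<Rightarrow> 'a word" where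
  "inv_word w \<equiv> rev (map bar w)"

lemma reduced_reduce [simp]: "reduced (reduce w)"
  by (simp add: reduce_def reduced_foldr_cancel)

lemma reduce_Nil [simp]: "reduce [] = []"
  by (simp add: reduce_def)

lemma reduce_Cons: "reduce (x # w) = cancel x (reduce w)"
  by (simp add: reduce_def)

lemma reduce_append_reduce_right [simp]: "reduce (u @ reduce v) = reduce (u @ v)"
proof -
  have "foldr cancel (reduce v) [] = reduce v"
    using reduce_reduced[of "reduce v"] unfolding reduce_def[of "reduce v"] by simp
  then show ?thesis by (simp add: reduce_def)
qed

lemma reduce_append_reduce_left [simp]: "reduce (reduce u @ v) = reduce (u @ v)"
proof -
  have "foldr cancel (foldr cancel u []) (foldr cancel v []) = foldr cancel u (foldr cancel v [])"
    by (subst foldr_cancel_foldr) (simp_all add: reduced_foldr_cancel)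
  then show ?thesis by (simp add: reduce_def)
qed

lemma reduce_cancel_pair: "reduce (u @ x # bar x # v) = reduce (u @ v)"
proof -
  have "reduce (x # bar x # v) = reduce v"
    using cancel_cancel[of "reduce v" "bar x"] by (simp add: reduce_Cons)
  then show ?thesis
    by (metis reduce_append_reduce_right)
qed

lemma reduce_inv_word_append: "reduce (inv_word u @ u) = []"
  using foldr_cancel_inverse[of "[]" u] by (simp add: reduce_def)

lemma set_reduce: "set (reduce w) \<subseteq> set w"
  using set_foldr_cancel[of w "[]"] by (simp add: reduce_def)

lemma reduced_append:
  "reduced (u @ v) \<longleftrightarrow> reduced u \<and> reduced v \<and> (u \<noteq> [] \<longrightarrow> v \<noteq> [] \<longrightarrow> hd v \<noteq> bar (last u))"
  by (auto simp: reduced_def successively_append_iff)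

lemma reduced_Cons: "reduced (x # w) \<longleftrightarrow> reduced w \<and> (w \<noteq> [] \<longrightarrow> hd w \<noteq> bar x)"
  using reduced_append[of "[x]" w] by (auto simp: reduced_def)

lemma reduced_singleton [simp]: "reduced [x]"
  by (simp add: reduced_def)

lemma bar_eq_iff: "x = bar y \<longleftrightarrow> y = bar x"
  by auto

lemma reduced_inv_word: "reduced w \<Longrightarrow> reduced (inv_word w)"
  unfolding reduced_def
  by (auto simp: successively_map successively_rev elim!: successively_mono)

lemma set_inv_word: "set w \<subseteq> letters A \<Longrightarrow> set (inv_word w) \<subseteq> letters A"
  using bar_mem_letters[of _ A] by auto

section \<open>Cyclically reduced words, their rotations and their periodic continuations\<close>

definition cyclically_reduced :: "'a word \<Rightarrow> bool" where
  "cyclically_reduced c \<longleftrightarrow> c \<noteq> [] \<and> reduced c \<and> hd c \<noteq> bar (last c)"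

lemma cyclically_reduced_rotate: 
  assumes "cyclically_reduced (x # d)"
  shows "cyclically_reduced (d @ [x])"
proof (cases "d = []")
  case False
  with assms show ?thesis
    by (auto simp: cyclically_reduced_def reduced_append reduced_Cons)
qed (use assms in simp)

lemma cyclically_reduced_rotate': 
  assumes "cyclically_reduced (d @ [x])"
  shows "cyclically_reduced (x # d)"
proof (cases "d = []")
  case False
  with assms show ?thesis
    by (auto simp: cyclically_reduced_def reduced_append reduced_Cons)
qed (use assms in simp)

text \<open>As long as the two end letters are inverse to each other they are stripped off into
  \<open>s\<close>; what remains is the cyclically reduced kernel.\<close>

lemma cyclically_reduced_conjugate:
  assumes "reduced h" "h \<noteq> []"
  shows "\<exists>s c. h = s @ c @ inv_word s \<and> cyclically_reduced c"
  using assms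
proof (induction "length h" arbitrary: h rule: less_induct)
  case less
  show ?case
  proof (cases "hd h = bar (last h)")
    case False
    with less.prems show ?thesis
      by (intro exI[of _ "[]"] exI[of _ h]) (auto simp: cyclically_reduced_def)
  next
    case True
    obtain x r where h: "h = x # r" using less.prems by (cases h) auto
    with True have "r \<noteq> []" by auto
    then obtain m y where r: "r = m @ [y]" by (meson rev_exhaust)
    have y: "y = bar x" using True h r by simp
    have red: "reduced ([x] @ m @ [bar x])" using less.prems h r y by simp
    \<comment> \<open>An empty \<open>m\<close> would leave \<open>[x, bar x]\<close>, which is not
      reduced, so the kernel never vanishes.\<close>
    then have "m \<noteq> []" by (auto simp: reduced_def)
    moreover have "reduced m" using red by (simp only: reduced_append)
    moreover have "length m < length h" using h r by simp
    ultimately obtain s c where "m = s @ c @ inv_word s" "cyclically_reduced c"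
      using less.hyps by blast
    then show ?thesis using h r y
      by (intro exI[of _ "x # s"] exI[of _ c]) auto
  qed
qed

text \<open>For nonempty \<open>c\<close> this is the prefix of length \<open>n\<close> of the
  infinite word \<open>c c c ...\<close>. Rotating \<open>c\<close> at each letter matches walking
  around a loop: the next vertex carries a loop labeled by the rotated word.\<close>

fun periodic_prefix :: "nat \<Rightarrow> 'a word \<Rightarrow> 'a word" where
  "periodic_prefix 0 c = []"
| "periodic_prefix (Suc n) c = hd c # periodic_prefix n (rotate1 c)"

lemma length_periodic_prefix [simp]: "length (periodic_prefix n c) = n"
  by (induction n arbitrary: c) auto

lemma cyclically_reduced_rotate1:
  "cyclically_reduced c \<Longrightarrow> cyclically_reduced (rotate1 c)"
  by (cases c) (auto simp: cyclically_reduced_rotate)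

lemma reduced_periodic_prefix:
  "cyclically_reduced c \<Longrightarrow> reduced (periodic_prefix n c)"
proof (induction n arbitrary: c)
  case (Suc n)
  obtain x d where c: "c = x # d" using Suc.prems by (cases c) (auto simp: cyclically_reduced_def)
  have "hd (rotate1 c) \<noteq> bar x"
  proof (cases d)
    case Nil then show ?thesis using c by simp
  next
    case (Cons y e)
    then show ?thesis using Suc.prems c by (simp add: cyclically_reduced_def reduced_Cons)
  qed
  moreover have "reduced (periodic_prefix n (rotate1 c))"
    using Suc.IH Suc.prems cyclically_reduced_rotate1 by blast
  ultimately show ?case using c by (cases n) (auto simp: reduced_Cons)
qed simp


section \<open>The free group and its cosets\<close>

lemma carrier_free_group: "w \<in> carrier (free_group A) \<longleftrightarrow> reduced w \<and> set w \<subseteq> letters A"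
  by (simp add: free_group_def)

lemma one_free_group [simp]: "\<one>\<^bsub>free_group A\<^esub> = []"
  by (simp add: free_group_def)

lemma mult_free_group: "u \<otimes>\<^bsub>free_group A\<^esub> v = reduce (u @ v)"
  by (simp add: free_group_def)

lemma reduce_in_carrier: "set w \<subseteq> letters A \<Longrightarrow> reduce w \<in> carrier (free_group A)"
  using set_reduce by (fastforce simp: carrier_free_group)

lemma singleton_in_carrier [simp]: "[x] \<in> carrier (free_group A) \<longleftrightarrow> x \<in> letters A"
  by (auto simp: carrier_free_group)

lemma inv_reduce:
  assumes "set u \<subseteq> letters A"
  shows "inv\<^bsub>free_group A\<^esub> (reduce u) = reduce (inv_word u)"
  using assms reduce_in_carrier[OF assms] reduce_in_carrier[OF set_inv_word[OF assms]]
  by (intro group.inv_equality[OF group_free_group])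
    (simp_all add: mult_free_group reduce_inv_word_append)

lemma rcoset_eq_iff:
  fixes G (structure)
  assumes "group G" "subgroup K G" "x \<in> carrier G" "y \<in> carrier G"
  shows "K #> x = K #> y \<longleftrightarrow> x \<otimes> inv y \<in> K"
proof -
  interpret group G by fact
  have K: "K \<subseteq> carrier G" by (rule subgroup.subset[OF assms(2)])
  have xy: "x \<otimes> inv y \<in> carrier G" using assms by blast
  show ?thesis
    using coset_join1[OF _ xy assms(2)] coset_join2[OF xy assms(2)]
      coset_mult_inv1[OF _ assms(3,4) K] coset_mult_inv2[OF _ assms(3,4) K] by blast
qed

text \<open>Two words lead from \<open>K\<close> to the same vertex of the Schreier graph iff the
  first followed by the inverse of the second reduces into \<open>K\<close>.\<close>

lemma rcoset_reduce_eq_iff: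
  assumes "subgroup K (free_group A)" "set u \<subseteq> letters A" "set v \<subseteq> letters A"
  shows "K #>\<^bsub>free_group A\<^esub> reduce u = K #>\<^bsub>free_group A\<^esub> reduce v \<longleftrightarrow>
    reduce (u @ inv_word v) \<in> K"
  unfolding rcoset_eq_iff[OF group_free_group assms(1)
      reduce_in_carrier[OF assms(2)] reduce_in_carrier[OF assms(3)]]
  using assms(3) by (simp add: inv_reduce mult_free_group)


section \<open>Paths in labeled graphs\<close>

text \<open>The part of the graph axioms that survives every map of vertices; determinism is kept
  separate because an identification may destroy it before the foldings restore it.\<close>

definition labeled_graph :: "'a set \<Rightarrow> ('v, 'a) lgraph \<Rightarrow> bool" where
  "labeled_graph A \<Gamma> \<longleftrightarrow> edges \<Gamma> \<subseteq> verts \<Gamma> \<times> A \<times> verts \<Gamma>"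

text \<open>As \<open>x\<close> ranges over positive and negative letters, this covers both the
  uniqueness of targets and that of sources.\<close>

definition deterministic :: "('v, 'a) lgraph \<Rightarrow> bool" where
  "deterministic \<Gamma> \<longleftrightarrow> (\<forall>p x q q'. step \<Gamma> p x q \<and> step \<Gamma> p x q' \<longrightarrow> q = q')"

lemma deterministicD: "deterministic \<Gamma> \<Longrightarrow> step \<Gamma> p x q \<Longrightarrow> step \<Gamma> p x q' \<Longrightarrow> q = q'"
  unfolding deterministic_def by blast

lemma deterministic_iff_not_foldable: "deterministic \<Gamma> \<longleftrightarrow> (\<forall>p p'. \<not> foldable \<Gamma> p p')"
  unfolding deterministic_def foldable_def by blast

lemma deterministic_iff_edges:
  "deterministic \<Gamma> \<longleftrightarrow>
     (\<forall>p a q q'. (p, a, q) \<in> edges \<Gamma> \<and> (p, a, q') \<in> edges \<Gamma> \<longrightarrow> q = q') \<and>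
     (\<forall>p p' a q. (p, a, q) \<in> edges \<Gamma> \<and> (p', a, q) \<in> edges \<Gamma> \<longrightarrow> p = p')"
  (is "_ \<longleftrightarrow> ?R")
proof
  assume d: "deterministic \<Gamma>"
  show ?R
    using deterministicD[OF d, of _ "Pos _"] deterministicD[OF d, of _ "Neg _"]
    by (simp, blast)
next
  assume R: ?R
  show "deterministic \<Gamma>"
    unfolding deterministic_def
  proof (intro allI impI)
    fix p x q q' assume "step \<Gamma> p x q \<and> step \<Gamma> p x q'"
    with R show "q = q'" by (cases x; simp) blast+
  qed
qed

lemma step_bar [simp]: "step \<Gamma> p (bar x) q \<longleftrightarrow> step \<Gamma> q x p"
  by (cases x) auto

lemma stepD:
  assumes "labeled_graph A \<Gamma>" "step \<Gamma> p x q"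
  shows "p \<in> verts \<Gamma>" "q \<in> verts \<Gamma>" "x \<in> letters A"
  using assms by (cases x; force simp: labeled_graph_def letters_def)+

lemma path_verts:
  assumes "labeled_graph A \<Gamma>" "path \<Gamma> p w q"
  shows "p \<in> verts \<Gamma>" "q \<in> verts \<Gamma>"
  using assms(2) by (induction w arbitrary: p) (auto dest: stepD[OF assms(1)])

lemma path_letters:
  assumes "labeled_graph A \<Gamma>" "path \<Gamma> p w q"
  shows "set w \<subseteq> letters A"
  using assms(2) by (induction w arbitrary: p) (auto dest: stepD[OF assms(1)])

lemma path_append:
  assumes "labeled_graph A \<Gamma>"
  shows "path \<Gamma> p (u @ v) q \<longleftrightarrow> (\<exists>r. path \<Gamma> p u r \<and> path \<Gamma> r v q)"
  by (induction u arbitrary: p) (auto dest: path_verts[OF assms])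

lemma path_singleton:
  assumes "labeled_graph A \<Gamma>"
  shows "path \<Gamma> p [x] q \<longleftrightarrow> step \<Gamma> p x q"
  by (auto dest: stepD[OF assms])

lemma path_inv_word:
  assumes "labeled_graph A \<Gamma>"
  shows "path \<Gamma> p w q \<Longrightarrow> path \<Gamma> q (inv_word w) p"
proof (induction w arbitrary: p)
  case (Cons x w)
  then obtain r where "step \<Gamma> p x r" "path \<Gamma> r w q" by auto
  with Cons.IH show ?case
    by (auto simp: path_append[OF assms] dest: stepD[OF assms])
qed auto

lemma path_deterministic:
  assumes "deterministic \<Gamma>"
  shows "path \<Gamma> p w q \<Longrightarrow> path \<Gamma> p w q' \<Longrightarrow> q = q'"
  by (induction w arbitrary: p) (auto dest: deterministicD[OF assms])

lemma path_reduce: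
  assumes "labeled_graph A \<Gamma>" "deterministic \<Gamma>"
  shows "path \<Gamma> p w q \<Longrightarrow> path \<Gamma> p (reduce w) q"
proof (induction w arbitrary: p)
  case (Cons x w)
  then obtain r where r: "step \<Gamma> p x r" "path \<Gamma> r (reduce w) q" by auto
  show ?case
  proof (cases "\<exists>w'. reduce w = bar x # w'")
    case True
    then obtain w' where w': "reduce w = bar x # w'" by blast
    with r obtain s where "step \<Gamma> s x r" "path \<Gamma> s w' q" by auto
    moreover from this r have "s = p"
      using deterministicD[OF assms(2), of r "bar x"] by simp
    ultimately show ?thesis using w' by (simp add: reduce_Cons)
  next
    case False
    then have "reduce (x # w) = x # reduce w"
      by (cases "reduce w") (auto simp: reduce_Cons)
    with r show ?thesis by auto
  qed
qed simp

lemma subgroup_loops: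
  assumes "labeled_graph A \<Gamma>" "deterministic \<Gamma>" "b \<in> verts \<Gamma>"
  shows "subgroup {w \<in> carrier (free_group A). path \<Gamma> b w b} (free_group A)"
proof -
  interpret group "free_group A" by (rule group_free_group)
  show ?thesis
  proof (rule subgroupI)
    show "{w \<in> carrier (free_group A). path \<Gamma> b w b} \<noteq> {}"
      using assms(3) by (auto intro!: exI[of _ "[]"] simp: carrier_free_group)
  next
    fix u assume u: "u \<in> {w \<in> carrier (free_group A). path \<Gamma> b w b}"
    then have "inv\<^bsub>free_group A\<^esub> u = reduce (inv_word u)"
      using inv_reduce[of u A] by (simp add: carrier_free_group reduce_reduced)
    moreover have "path \<Gamma> b (reduce (inv_word u)) b"
      using u path_inv_word[OF assms(1)] path_reduce[OF assms(1,2)] by blast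
    ultimately show "inv\<^bsub>free_group A\<^esub> u \<in> {w \<in> carrier (free_group A). path \<Gamma> b w b}"
      using u by (metis (no_types, lifting) inv_closed mem_Collect_eq)
  next
    fix u v assume uv: "u \<in> {w \<in> carrier (free_group A). path \<Gamma> b w b}"
      "v \<in> {w \<in> carrier (free_group A). path \<Gamma> b w b}"
    then have "path \<Gamma> b (u @ v) b"
      using path_append[OF assms(1)] by blast
    then have "path \<Gamma> b (u \<otimes>\<^bsub>free_group A\<^esub> v) b"
      using path_reduce assms by (simp add: mult_free_group)
    with uv show "u \<otimes>\<^bsub>free_group A\<^esub> v \<in> {w \<in> carrier (free_group A). path \<Gamma> b w b}"
      by simp
  qed auto
qed


section \<open>Outgoing letters and degrees\<close>

text \<open>Replaces the degree in deterministic graphs: a loop edge contributes two letters, just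
  as it counts twice in the degree, and the set can only grow under maps of vertices.\<close>

definition out_letters :: "('v, 'a) lgraph \<Rightarrow> 'v \<Rightarrow> 'a letter set" where
  "out_letters \<Gamma> p = {x. \<exists>q. step \<Gamma> p x q}"

lemma degree_eq_card_out_letters:
  assumes "deterministic \<Gamma>" "finite (edges \<Gamma>)"
  shows "degree \<Gamma> p = card (out_letters \<Gamma> p)" "finite (out_letters \<Gamma> p)"
proof -
  let ?I = "{(r, a, q) \<in> edges \<Gamma>. q = p}" and ?O = "{(r, a, q) \<in> edges \<Gamma>. r = p}"
  have fin: "finite ?I" "finite ?O"
    using assms(2) by (auto elim: rev_finite_subset)
  have inj: "inj_on (\<lambda>(r, a, q). Neg a) ?I" "inj_on (\<lambda>(r, a, q). Pos a) ?O"
    using assms(1) unfolding deterministic_iff_edges inj_on_def by (auto, blast+)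
  have out: "out_letters \<Gamma> p = (\<lambda>(r, a, q). Neg a) ` ?I \<union> (\<lambda>(r, a, q). Pos a) ` ?O" (is "_ = ?U")
  proof (rule Set.set_eqI)
    fix x show "x \<in> out_letters \<Gamma> p \<longleftrightarrow> x \<in> ?U"
      by (cases x) (auto simp: out_letters_def image_iff)
  qed
  show "finite (out_letters \<Gamma> p)"
    unfolding out using fin by blast
  have "card ?U = card ((\<lambda>(r, a, q). Neg a) ` ?I) + card ((\<lambda>(r, a, q). Pos a) ` ?O)"
    using fin by (intro card_Un_disjoint) auto
  then show "degree \<Gamma> p = card (out_letters \<Gamma> p)"
    unfolding out degree_def using inj by (simp add: card_image)
qed

lemma degree_ge_2_iff:
  assumes "deterministic \<Gamma>" "finite (edges \<Gamma>)"
  shows "degree \<Gamma> p \<ge> 2 \<longleftrightarrow> (\<exists>x\<in>out_letters \<Gamma> p. \<exists>y\<in>out_letters \<Gamma> p. x \<noteq> y)"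
  using degree_eq_card_out_letters[OF assms, of p] card_le_Suc0_iff_eq[of "out_letters \<Gamma> p"]
  by (auto simp: not_less_eq_eq numeral_2_eq_2)

lemma out_letters_degree_2:
  assumes "deterministic \<Gamma>" "finite (edges \<Gamma>)" "degree \<Gamma> p = 2"
    and "x \<in> out_letters \<Gamma> p" "y \<in> out_letters \<Gamma> p" "x \<noteq> y"
  shows "out_letters \<Gamma> p = {x, y}"
proof -
  have "{x, y} = out_letters \<Gamma> p"
    using assms degree_eq_card_out_letters[OF assms(1,2), of p]
    by (intro card_subset_eq) auto
  then show ?thesis by simp
qed

lemma stallingsD:
  assumes "stallings A \<Gamma> b H"
  shows "labeled_graph A \<Gamma>" "deterministic \<Gamma>" "finite (verts \<Gamma>)" "finite (edges \<Gamma>)" "b \<in> verts \<Gamma>"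
    "p \<in> verts \<Gamma> \<Longrightarrow> q \<in> verts \<Gamma> \<Longrightarrow> \<exists>w. path \<Gamma> p w q"
    "p \<in> verts \<Gamma> \<Longrightarrow> p \<noteq> b \<Longrightarrow> degree \<Gamma> p \<ge> 2"
    "H = {w \<in> carrier (free_group A). path \<Gamma> b w b}" "subgroup H (free_group A)"
proof -
  show *: "labeled_graph A \<Gamma>" "deterministic \<Gamma>" "b \<in> verts \<Gamma>"
    and H: "H = {w \<in> carrier (free_group A). path \<Gamma> b w b}"
    using assms
    by (simp_all add: stallings_def finite_connected_graph_def labeled_graph_def deterministic_iff_edges)
  show "subgroup H (free_group A)"
    unfolding H by (rule subgroup_loops[OF *])
  show "finite (verts \<Gamma>)" "finite (edges \<Gamma>)"
    "p \<in> verts \<Gamma> \<Longrightarrow> q \<in> verts \<Gamma> \<Longrightarrow> \<exists>w. path \<Gamma> p w q"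
    "p \<in> verts \<Gamma> \<Longrightarrow> p \<noteq> b \<Longrightarrow> degree \<Gamma> p \<ge> 2"
    using assms unfolding stallings_def finite_connected_graph_def by blast+
qed

lemma path_in_stallings:
  assumes "stallings A \<Gamma> b H" "path \<Gamma> b w b"
  shows "reduce w \<in> H"
  using assms(2) path_reduce[OF stallingsD(1,2)[OF assms(1)]]
    path_letters[OF stallingsD(1)[OF assms(1)]] stallingsD(8)[OF assms(1)]
  by (simp add: reduce_in_carrier)

text \<open>The first path followed by the reverse of the second is a loop at \<open>b\<close>, so
  the two words differ by an element of \<open>H\<close>, hence of \<open>K\<close>.\<close>

lemma stallings_rcoset_eq:
  assumes "stallings A \<Gamma> b H" "path \<Gamma> b u p" "path \<Gamma> b v p" "H \<subseteq> K" "subgroup K (free_group A)"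
  shows "K #>\<^bsub>free_group A\<^esub> reduce u = K #>\<^bsub>free_group A\<^esub> reduce v"
proof -
  note G = stallingsD[OF assms(1)]
  have uv: "set u \<subseteq> letters A" "set v \<subseteq> letters A"
    using assms path_letters[OF G(1)] by blast+
  have "path \<Gamma> b (u @ inv_word v) b"
    using assms path_append[OF G(1)] path_inv_word[OF G(1)] by blast
  then have "reduce (u @ inv_word v) \<in> K"
    using path_in_stallings[OF assms(1)] assms(4) by blast
  then show ?thesis
    using rcoset_reduce_eq_iff[OF assms(5) uv] by simp
qed


section \<open>Subgraphs and the core\<close>

lemma verts_core: "verts (core \<Gamma> b) \<subseteq> verts \<Gamma>"
  by (auto simp: core_def)

lemma step_core: "step (core \<Gamma> b) p x q \<Longrightarrow> step \<Gamma> p x q"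
  by (cases x) (auto simp: core_def split: if_splits)

lemma path_core: "path (core \<Gamma> b) p w q \<Longrightarrow> path \<Gamma> p w q"
  using verts_core[of \<Gamma> b] by (induction w arbitrary: p) (auto dest: step_core)

lemma path_take:
  assumes "labeled_graph A \<Gamma>" "path \<Gamma> p w q"
  obtains r where "path \<Gamma> p (take i w) r"
  using assms path_append[OF assms(1), of p "take i w" "drop i w" q] by auto

text \<open>Pigeonhole: along a long common word, the pair of current vertices repeats.\<close>

lemma infinite_pair_loop:
  assumes "stallings A \<Gamma> b H" "finite A" "(p, q) \<in> infinite_pairs \<Gamma> b"
  obtains u c p' q' where "path \<Gamma> p u p'" "path \<Gamma> q u q'" "path \<Gamma> p' c p'" "path \<Gamma> q' c q'"
    "reduced c" "c \<noteq> []"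
proof -
  note G = stallingsD[OF assms(1)]
  let ?N = "card (verts \<Gamma> \<times> verts \<Gamma>)"
  let ?L = "core_language \<Gamma> b p \<inter> core_language \<Gamma> b q"
  have fin: "finite (letters A)" using assms(2) by (simp add: letters_def)
  have inf: "infinite ?L" using assms(3) by (simp add: infinite_pairs_def)
  have L: "reduced w \<and> (\<exists>p'. path \<Gamma> p w p') \<and> (\<exists>q'. path \<Gamma> q w q')" if "w \<in> ?L" for w
    using that path_core by (fastforce simp: core_language_def)
  \<comment> \<open>Over a finite alphabet only finitely many words have length at most
    \<open>?N\<close>, so an infinite set contains a longer one.\<close>
  have "\<not> ?L \<subseteq> {w. set w \<subseteq> letters A \<and> length w \<le> ?N}"
    using finite_lists_length_le[OF fin, of ?N] finite_subset inf by blast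
  then obtain w where w: "w \<in> ?L" "\<not> (set w \<subseteq> letters A \<and> length w \<le> ?N)"
    by blast
  have "set w \<subseteq> letters A"
    using L[OF w(1)] path_letters[OF G(1)] by blast
  with w have w: "w \<in> ?L" "length w > ?N" by simp_all
  \<comment> \<open>The vertices reached from \<open>p\<close> and \<open>q\<close> after the first
    \<open>i\<close> letters of \<open>w\<close>.\<close>
  define P Q where "P i = (SOME r. path \<Gamma> p (take i w) r)"
    and "Q i = (SOME r. path \<Gamma> q (take i w) r)" for i
  have P: "path \<Gamma> p (take i w) (P i)" and Q: "path \<Gamma> q (take i w) (Q i)" for i
    unfolding P_def Q_def
    using L[OF w(1)] path_take[OF G(1)] by (metis (no_types, lifting) someI_ex)+
  \<comment> \<open>There are \<open>?N + 1\<close> indices but only \<open>?N\<close> pairs of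
    vertices.\<close>
  have "\<not> inj_on (\<lambda>i. (P i, Q i)) {..?N}"
  proof
    assume "inj_on (\<lambda>i. (P i, Q i)) {..?N}"
    then have "card {..?N} \<le> ?N"
      using path_verts(2)[OF G(1) P] path_verts(2)[OF G(1) Q] G(3) by (intro card_inj_on_le) auto
    then show False by simp
  qed
  then obtain i j where ij: "i < j" "j \<le> ?N" "P i = P j" "Q i = Q j"
    unfolding inj_on_def by (metis atMost_iff linorder_neqE_nat prod.inject)
  define c where "c = drop i (take j w)"
  have take: "take j w = take i w @ c"
    using ij(1) by (metis append_take_drop_id c_def less_imp_le_nat min_absorb1 take_take)
  have "c \<noteq> []" using ij w(2) by (simp add: c_def)
  moreover have "reduced (take i w @ c @ drop j w)"
    using L[OF w(1)] by (metis append.assoc append_take_drop_id take)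
  then have "reduced c" by (simp only: reduced_append)
  moreover have "path \<Gamma> (P i) c (P i)"
    using P[of i] P[of j] ij(3) path_deterministic[OF G(2)] unfolding take path_append[OF G(1)] by metis
  moreover have "path \<Gamma> (Q i) c (Q i)"
    using Q[of i] Q[of j] ij(4) path_deterministic[OF G(2)] unfolding take path_append[OF G(1)] by metis
  ultimately show ?thesis using that P Q by blast
qed

text \<open>The two neighbours of a degree-2 vertex on a cyclically reduced loop lie on the loop, too,
  so the tail cannot grow into the loop.\<close>

lemma cyclically_reduced_loop_not_in_tail:
  assumes "stallings A \<Gamma> b H" "\<not> degree \<Gamma> b \<ge> 2"
  shows "p \<in> tail \<Gamma> b \<Longrightarrow> cyclically_reduced c \<Longrightarrow> \<not> path \<Gamma> p c p"
proof (induction arbitrary: c rule: tail.induct)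
  note G = stallingsD[OF assms(1)]
  have loop: "hd c \<in> out_letters \<Gamma> p" "bar (last c) \<in> out_letters \<Gamma> p" "hd c \<noteq> bar (last c)"
    if c: "cyclically_reduced c" "path \<Gamma> p c p" for p c
  proof -
    have "c \<noteq> []" using c(1) by (simp add: cyclically_reduced_def)
    then show "hd c \<in> out_letters \<Gamma> p"
      using c(2) by (cases c) (auto simp: out_letters_def)
    have "path \<Gamma> p (butlast c @ [last c]) p" using c(2) \<open>c \<noteq> []\<close> by simp
    then show "bar (last c) \<in> out_letters \<Gamma> p"
      unfolding path_append[OF G(1)] path_singleton[OF G(1)] by (auto simp: out_letters_def)
    show "hd c \<noteq> bar (last c)" using c(1) by (simp add: cyclically_reduced_def)
  qed
  {
    \<comment> \<open>A loop of this kind gives \<open>b\<close> two distinct outgoing letters,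
      against its degree being less than 2.\<close>
    case base
    then show ?case
      using loop[of c b] assms(2) degree_ge_2_iff[OF G(2,4)] by blast
  next
    case (step p q)
    show ?case
    proof
      assume q: "path \<Gamma> q c q"
      obtain x where x: "step \<Gamma> q x p"
        using step.hyps(2) unfolding adjacent_def by (metis step_bar)
      then have "x \<in> out_letters \<Gamma> q" by (auto simp: out_letters_def)
      then consider "x = hd c" | "x = bar (last c)"
        using out_letters_degree_2[OF G(2,4) step.hyps(3) loop[OF step.prems q]] by blast
      then show False
      proof cases
        \<comment> \<open>Here \<open>p\<close> is the vertex that follows \<open>q\<close> on the
          loop; rotating \<open>c\<close> forward moves the base of the loop to
          \<open>p\<close>.\<close>
        case 1
        obtain d where c: "c = x # d" using step.prems 1
          by (cases c) (auto simp: cyclically_reduced_def)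
        then have "path \<Gamma> p d q" using q x deterministicD[OF G(2)] by auto
        then have "path \<Gamma> p (d @ [x]) p"
          using x path_append[OF G(1)] path_singleton[OF G(1)] by blast
        then show False using step.IH cyclically_reduced_rotate step.prems c by blast
      next
        \<comment> \<open>Here \<open>p\<close> is the vertex that precedes \<open>q\<close> on the
          loop; \<open>c\<close> is rotated backward.\<close>
        case 2
        obtain d where c: "c = d @ [bar x]" using step.prems 2
          by (cases c rule: rev_cases) (auto simp: cyclically_reduced_def)
        then obtain r where "path \<Gamma> q d r" "step \<Gamma> q x r"
          using q path_append[OF G(1)] path_singleton[OF G(1)] by (metis step_bar)
        with x have "path \<Gamma> p (bar x # d) p"
          using deterministicD[OF G(2)] by fastforce
        then show False using step.IH cyclically_reduced_rotate' step.prems c by blast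
      qed
    qed
  }
qed

text \<open>Each vertex on the loop carries a loop labeled by a rotation of \<open>c\<close>, so
  none of them lies in the tail. The whole loop therefore survives in the core and can be traversed
  indefinitely.\<close>

lemma cyclically_reduced_loop_in_core:
  assumes "stallings A \<Gamma> b H" "cyclically_reduced c" "path \<Gamma> p c p"
  shows "p \<in> verts (core \<Gamma> b)" "periodic_prefix n c \<in> core_language \<Gamma> b p"
proof -
  note G = stallingsD[OF assms(1)]
  have not_tail: "p \<notin> tail \<Gamma> b"
    if "\<not> (\<forall>p \<in> verts \<Gamma>. degree \<Gamma> p \<ge> 2)" "cyclically_reduced c" "path \<Gamma> p c p" for p c
  proof -
    have "\<not> degree \<Gamma> b \<ge> 2" using that(1) G(7) by blast
    then show ?thesis using cyclically_reduced_loop_not_in_tail[OF assms(1)] that(2,3) by blast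
  qed
  have core: "p \<in> verts (core \<Gamma> b)" if "cyclically_reduced c" "path \<Gamma> p c p" for p c
    using not_tail[OF _ that] that(2) path_verts[OF G(1)] by (auto simp: core_def)
  have "\<exists>q. path (core \<Gamma> b) p (periodic_prefix n c) q"
    using assms(2,3)
  proof (induction n arbitrary: p c)
    case 0
    then show ?case using core by auto
  next
    case (Suc n)
    obtain x d where c: "c = x # d" using Suc.prems by (cases c) (auto simp: cyclically_reduced_def)
    then obtain r where r: "step \<Gamma> p x r" "path \<Gamma> r d p" using Suc.prems(2) by auto
    then have loop: "path \<Gamma> r (rotate1 c) r"
      using path_append[OF G(1)] path_singleton[OF G(1)] c by auto
    note rot = cyclically_reduced_rotate1[OF Suc.prems(1)]
    \<comment> \<open>Both ends of the edge avoid the tail: \<open>p\<close> by its loop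
      \<open>c\<close>, and \<open>r\<close> by its loop \<open>rotate1 c\<close>.\<close>
    have "step (core \<Gamma> b) p x r"
      using r(1) not_tail[OF _ Suc.prems] not_tail[OF _ rot loop] by (cases x) (auto simp: core_def)
    then show ?case using Suc.IH[OF rot loop] c by auto
  qed
  then show "periodic_prefix n c \<in> core_language \<Gamma> b p"
    using reduced_periodic_prefix[OF assms(2)] by (auto simp: core_language_def)
  show "p \<in> verts (core \<Gamma> b)" using core assms(2,3) by blast
qed

lemma infinite_pairs_of_common_loop:
  assumes "stallings A \<Gamma> b H" "cyclically_reduced c" "path \<Gamma> p c p" "path \<Gamma> q c q" "p \<noteq> q"
  shows "(p, q) \<in> infinite_pairs \<Gamma> b"
proof -
  \<comment> \<open>Prefixes for different \<open>n\<close> differ in length, so infinitely many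
    words are common to both languages.\<close>
  have "inj (\<lambda>n. periodic_prefix n c)"
    by (metis injI length_periodic_prefix)
  then have "infinite (range (\<lambda>n. periodic_prefix n c))"
    by (metis finite_imageD infinite_UNIV_nat)
  moreover have "range (\<lambda>n. periodic_prefix n c) \<subseteq> core_language \<Gamma> b p \<inter> core_language \<Gamma> b q"
    using cyclically_reduced_loop_in_core(2)[OF assms(1,2)] assms(3,4) by blast
  ultimately have "infinite (core_language \<Gamma> b p \<inter> core_language \<Gamma> b q)"
    using finite_subset by blast
  then show ?thesis
    using cyclically_reduced_loop_in_core(1)[OF assms(1,2)] assms(3-5) by (simp add: infinite_pairs_def)
qed


section \<open>Malnormality\<close>

text \<open>With \<open>g = s \<otimes> inv t\<close>, the two conjugates of \<open>c\<close> in
  \<open>K\<close> are conjugate to each other by \<open>g\<close>. If \<open>g\<close> were outside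
  \<open>K\<close>, malnormality would make them trivial, and then \<open>c\<close> as well.
  Geometrically: vertices of the Schreier graph with a common nontrivial loop label
  coincide.\<close>

lemma malnormal_rcoset_eq:
  fixes G (structure)
  assumes "group G" "malnormal G K" "s \<in> carrier G" "t \<in> carrier G" "c \<in> carrier G" "c \<noteq> \<one>"
    and "s \<otimes> c \<otimes> inv s \<in> K" "t \<otimes> c \<otimes> inv t \<in> K"
  shows "K #> s = K #> t"
proof -
  interpret group G by fact
  have K: "subgroup K G" using assms(2) by (simp add: malnormal_def)
  define g where "g = s \<otimes> inv t"
  have g: "g \<in> carrier G" using assms by (simp add: g_def)
  have "g \<in> K"
  proof (rule ccontr)
    assume "g \<notin> K"
    then have K1: "conjugate G K g \<inter> K = {\<one>}"
      using assms(2) g by (auto simp: malnormal_def)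
    have "inv g = t \<otimes> inv s" using assms by (simp add: g_def inv_mult_group)
    then have "inv g \<otimes> (s \<otimes> c \<otimes> inv s) \<otimes> g = t \<otimes> c \<otimes> inv t"
      using assms by (simp add: g_def m_assoc inv_solve_left')
    then have "t \<otimes> c \<otimes> inv t = \<one>"
      using K1 assms(7,8) unfolding conjugate_def by force
    then show False using assms(3-6)
      by (metis inv_closed inv_equality inv_inv l_cancel_one m_closed r_cancel_one inv_comm)
  qed
  then show ?thesis
    using rcoset_eq_iff[OF assms(1) K assms(3,4)] by (simp add: g_def)
qed

text \<open>The vertex \<open>K #> t\<close> of the Schreier graph of \<open>K\<close> carries a cyclically reduced loop, so
  it belongs to the finite graph \<open>\<Gamma>\<close>: as long as \<open>t c t\<^sup>-\<^sup>1\<close> is not reduced, rotate \<open>c\<close> and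
  shorten \<open>t\<close>.\<close>

lemma rcoset_loop_in_stallings:
  assumes "stallings A \<Gamma> b K"
  shows "\<lbrakk>reduced t; set t \<subseteq> letters A; cyclically_reduced c; set c \<subseteq> letters A;
          reduce (t @ c @ inv_word t) \<in> K\<rbrakk> \<Longrightarrow>
    \<exists>v q. path \<Gamma> b v q \<and> path \<Gamma> q c q \<and>
      K #>\<^bsub>free_group A\<^esub> reduce v = K #>\<^bsub>free_group A\<^esub> reduce t"
proof (induction t arbitrary: c rule: rev_induct)
  note G = stallingsD[OF assms]
  case Nil
  then have "path \<Gamma> b c b"
    using G(8) by (auto simp: cyclically_reduced_def reduce_reduced)
  then show ?case using G(5) by (intro exI[of _ "[]"] exI[of _ b]) auto
next
  note G = stallingsD[OF assms]
  case (snoc x t)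
  have red: "reduced t" and t: "set t \<subseteq> letters A" "x \<in> letters A"
    using snoc.prems by (auto simp: reduced_append)
  \<comment> \<open>Equal cosets stay equal after moving along the letter \<open>x\<close>; this
    carries the conclusion from \<open>t\<close> to \<open>t @ [x]\<close>.\<close>
  have eq: "K #>\<^bsub>free_group A\<^esub> reduce (v @ [x]) = K #>\<^bsub>free_group A\<^esub> reduce (t @ [x])"
    if "path \<Gamma> b v q" "K #>\<^bsub>free_group A\<^esub> reduce v = K #>\<^bsub>free_group A\<^esub> reduce t" for v q
  proof -
    have v: "set v \<subseteq> letters A" using path_letters[OF G(1) that(1)] .
    have "reduce (v @ inv_word t) \<in> K"
      using that(2) rcoset_reduce_eq_iff[OF G(9) v t(1)] by blast
    then have "reduce ((v @ [x]) @ inv_word (t @ [x])) \<in> K"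
      by (simp add: reduce_cancel_pair)
    then show ?thesis
      using rcoset_reduce_eq_iff[OF G(9), of "v @ [x]" "t @ [x]"] v t by simp
  qed
  consider d where "c = bar x # d" | d where "c = d @ [x]" | "hd c \<noteq> bar x" "last c \<noteq> x"
    using snoc.prems(3) by (metis append_butlast_last_id cyclically_reduced_def list.collapse)
  then show ?case
  proof cases
    case (1 d)
    have "reduce (t @ (d @ [bar x]) @ inv_word t) \<in> K"
      using snoc.prems(5) reduce_cancel_pair[of t x "d @ bar x # inv_word t"] 1 by simp
    then obtain v q where vq: "path \<Gamma> b v q" "path \<Gamma> q (d @ [bar x]) q"
      "K #>\<^bsub>free_group A\<^esub> reduce v = K #>\<^bsub>free_group A\<^esub> reduce t"
      using snoc.IH[OF red t(1), of "d @ [bar x]"] cyclically_reduced_rotate[of "bar x" d]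
        snoc.prems(3,4) 1
      by auto
    then obtain r where r: "path \<Gamma> q d r" "step \<Gamma> q x r"
      using path_append[OF G(1)] path_singleton[OF G(1)] by (metis step_bar)
    then have "path \<Gamma> b (v @ [x]) r" "path \<Gamma> r c r"
      using vq(1) path_append[OF G(1)] path_singleton[OF G(1)] 1 by (blast, auto)
    then show ?thesis using eq[OF vq(1,3)] by blast
  next
    case (2 d)
    have "reduce (t @ (x # d) @ inv_word t) \<in> K"
      using snoc.prems(5) reduce_cancel_pair[of "t @ x # d" x "inv_word t"] 2 by simp
    then obtain v q where vq: "path \<Gamma> b v q" "path \<Gamma> q (x # d) q"
      "K #>\<^bsub>free_group A\<^esub> reduce v = K #>\<^bsub>free_group A\<^esub> reduce t"
      using snoc.IH[OF red t(1), of "x # d"] cyclically_reduced_rotate'[of d x] snoc.prems(3,4) 2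
      by auto
    then obtain r where r: "step \<Gamma> q x r" "path \<Gamma> r d q" by auto
    then have "path \<Gamma> b (v @ [x]) r" "path \<Gamma> r c r"
      using vq(1) path_append[OF G(1)] path_singleton[OF G(1)] 2 by blast+
    then show ?thesis using eq[OF vq(1,3)] by blast
  next
    case 3
    let ?t = "t @ [x]"
    have c: "c \<noteq> []" "reduced c" using snoc.prems(3) by (auto simp: cyclically_reduced_def)
    \<comment> \<open>Nothing cancels at either junction, so the word itself belongs to
      \<open>K\<close> and labels a loop at \<open>b\<close>.\<close>
    have "reduced (?t @ c @ inv_word ?t)"
      unfolding reduced_append[of ?t] reduced_append[of c]
      using snoc.prems(1) c 3 reduced_inv_word[OF snoc.prems(1)]
      by (auto simp: bar_eq_iff[of _ "last c"])
    then have "path \<Gamma> b (?t @ c @ inv_word ?t) b"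
      using snoc.prems(5) G(8) by (auto simp: reduce_reduced)
    then obtain q r where qr: "path \<Gamma> b ?t q" "path \<Gamma> q c r" "path \<Gamma> r (inv_word ?t) b"
      unfolding path_append[OF G(1)] by blast
    \<comment> \<open>Reading the last segment backwards also spells \<open>?t\<close> from
      \<open>b\<close>, so determinism identifies its end \<open>r\<close> with
      \<open>q\<close>.\<close>
    have "path \<Gamma> b ?t r" using path_inv_word[OF G(1) qr(3)] by (simp add: rev_map comp_def)
    then have "r = q" using path_deterministic[OF G(2) qr(1)] by simp
    then show ?thesis using qr by blast
  qed
qed

text \<open>Let \<open>k = s c s\<^sup>-\<^sup>1\<close> with \<open>c\<close> cyclically reduced,
  and let \<open>t = g\<^sup>-\<^sup>1 s\<close>. Then the conjugate of \<open>k\<close> by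
  \<open>g\<close> is \<open>t c t\<^sup>-\<^sup>1\<close>. If both lie in \<open>K\<close>, the
  cosets of \<open>s\<close> and \<open>t\<close> are represented by vertices of the graph with a
  \<open>c\<close>-loop. These vertices coincide when there are no infinite pairs, and so
  \<open>g = s t\<^sup>-\<^sup>1\<close> is in \<open>K\<close>.\<close>

lemma malnormal_if_no_infinite_pairs:
  assumes "stallings A \<Gamma> b K" "infinite_pairs \<Gamma> b = {}"
  shows "malnormal (free_group A) K"
proof -
  note G = stallingsD[OF assms(1)]
  interpret group "free_group A" by (rule group_free_group)
  let ?F = "free_group A"
  have one: "\<one>\<^bsub>?F\<^esub> \<in> K" "K \<subseteq> carrier ?F"
    using subgroup.one_closed[OF G(9)] subgroup.subset[OF G(9)] by auto
  have "g \<in> K" if g: "g \<in> carrier ?F" and k: "k \<in> K" "k \<noteq> []" "inv\<^bsub>?F\<^esub> g \<otimes>\<^bsub>?F\<^esub> k \<otimes>\<^bsub>?F\<^esub> g \<in> K"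
    for g k
  proof -
    have kF: "reduced k" "set k \<subseteq> letters A"
      using k(1) one(2) carrier_free_group[of k A] by blast+
    obtain s c where sc: "k = s @ c @ inv_word s" "cyclically_reduced c"
      using cyclically_reduced_conjugate[OF kF(1) k(2)] by blast
    have s: "reduced s" "set s \<subseteq> letters A" and c: "set c \<subseteq> letters A"
      using kF sc by (auto simp: reduced_append)
    have gr: "reduced g" "set g \<subseteq> letters A" using g by (auto simp: carrier_free_group)
    define t where "t = reduce (inv_word g @ s)"
    have "set (inv_word g @ s) \<subseteq> letters A" using set_inv_word gr s by auto
    then have t: "reduced t" "set t \<subseteq> letters A"
      using set_reduce[of "inv_word g @ s"] by (auto simp: t_def)
    have ig: "inv\<^bsub>?F\<^esub> g = reduce (inv_word g)"
      using inv_reduce[OF gr(2)] gr(1) by (simp add: reduce_reduced)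
    have sF: "s \<in> carrier ?F" and cF: "c \<in> carrier ?F" and tF: "t \<in> carrier ?F"
      using s c t sc by (auto simp: carrier_free_group cyclically_reduced_def)
    have conj: "reduce (u @ c @ inv_word u) = u \<otimes>\<^bsub>?F\<^esub> c \<otimes>\<^bsub>?F\<^esub> inv\<^bsub>?F\<^esub> u"
      if "u \<in> carrier ?F" for u
      using inv_reduce[of u A] that by (simp add: carrier_free_group mult_free_group reduce_reduced)
    have ts: "t = inv\<^bsub>?F\<^esub> g \<otimes>\<^bsub>?F\<^esub> s"
      by (simp add: t_def ig mult_free_group)
    have k': "k = s \<otimes>\<^bsub>?F\<^esub> c \<otimes>\<^bsub>?F\<^esub> inv\<^bsub>?F\<^esub> s"
      using conj[OF sF] sc(1) kF(1) by (simp add: reduce_reduced)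
    have "t \<otimes>\<^bsub>?F\<^esub> c \<otimes>\<^bsub>?F\<^esub> inv\<^bsub>?F\<^esub> t = inv\<^bsub>?F\<^esub> g \<otimes>\<^bsub>?F\<^esub> k \<otimes>\<^bsub>?F\<^esub> g"
      unfolding ts k' using g sF cF by (simp add: inv_mult_group m_assoc)
    then have tc: "reduce (t @ c @ inv_word t) \<in> K" using conj[OF tF] k(3) by simp
    have "reduce (s @ c @ inv_word s) \<in> K" using sc(1) kF(1) k(1) by (simp add: reduce_reduced)
    from rcoset_loop_in_stallings[OF assms(1) s sc(2) c this]
      rcoset_loop_in_stallings[OF assms(1) t sc(2) c tc]
    obtain u p v q where pq: "path \<Gamma> b u p" "path \<Gamma> p c p" "path \<Gamma> b v q" "path \<Gamma> q c q"
      and eq: "K #>\<^bsub>?F\<^esub> reduce u = K #>\<^bsub>?F\<^esub> reduce s" "K #>\<^bsub>?F\<^esub> reduce v = K #>\<^bsub>?F\<^esub> reduce t"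
      by blast
    have "p = q"
      using infinite_pairs_of_common_loop[OF assms(1) sc(2) pq(2,4)] assms(2) by blast
    then have "K #>\<^bsub>?F\<^esub> s = K #>\<^bsub>?F\<^esub> t"
      using stallings_rcoset_eq[OF assms(1) pq(1) _ subset_refl G(9)] pq(3) eq s(1) t(1)
      by (simp add: reduce_reduced)
    then have "s \<otimes>\<^bsub>?F\<^esub> inv\<^bsub>?F\<^esub> t \<in> K"
      using rcoset_eq_iff[OF group_free_group G(9) sF tF] by blast
    moreover have "s \<otimes>\<^bsub>?F\<^esub> inv\<^bsub>?F\<^esub> t = g"
      unfolding ts using g sF by (simp add: inv_mult_group m_assoc[symmetric] del: one_free_group)
    ultimately show ?thesis by simp
  qed
  note mem = this
  have "conjugate ?F K g \<inter> K \<subseteq> {\<one>\<^bsub>?F\<^esub>}" if g: "g \<in> carrier ?F" "g \<notin> K" for g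
  proof
    fix y assume y: "y \<in> conjugate ?F K g \<inter> K"
    then obtain k where k: "k \<in> K" "y = inv\<^bsub>?F\<^esub> g \<otimes>\<^bsub>?F\<^esub> k \<otimes>\<^bsub>?F\<^esub> g"
      unfolding conjugate_def by blast
    then have "k = \<one>\<^bsub>?F\<^esub>" using mem[OF g(1) k(1)] y g(2) by fastforce
    then show "y \<in> {\<one>\<^bsub>?F\<^esub>}" using k(2) g(1) by (simp del: one_free_group)
  qed
  moreover have "\<one>\<^bsub>?F\<^esub> \<in> conjugate ?F K g" if "g \<in> carrier ?F" for g
    unfolding conjugate_def
    by (rule image_eqI[OF _ one(1)]) (use that in \<open>simp del: one_free_group\<close>)
  ultimately show ?thesis
    unfolding malnormal_def using G(9) one(1) by blast
qed


section \<open>Images of graphs\<close>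

lemma verts_map_lgraph [simp]: "verts (map_lgraph f \<Gamma>) = f ` verts \<Gamma>"
  by (simp add: map_lgraph_def)

lemma step_map_lgraph:
  "step (map_lgraph f \<Gamma>) p' x q' \<longleftrightarrow> (\<exists>p q. step \<Gamma> p x q \<and> p' = f p \<and> q' = f q)"
  by (cases x) (force simp: map_lgraph_def)+

lemma map_lgraph_map_lgraph: "map_lgraph g (map_lgraph f \<Gamma>) = map_lgraph (g \<circ> f) \<Gamma>"
  by (simp add: map_lgraph_def image_comp case_prod_beta' comp_def)

lemma map_lgraph_ident [simp]: "map_lgraph (\<lambda>p. p) \<Gamma> = \<Gamma>"
  by (simp add: map_lgraph_def)

lemma labeled_graph_map: "labeled_graph A \<Gamma> \<Longrightarrow> labeled_graph A (map_lgraph f \<Gamma>)"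
  by (force simp: labeled_graph_def map_lgraph_def)

lemma path_map_lgraph: "path \<Gamma> p w q \<Longrightarrow> path (map_lgraph f \<Gamma>) (f p) w (f q)"
  by (induction w arbitrary: p) (auto simp: step_map_lgraph)

text \<open>Paths lift along a map injective on vertices, since consecutive lifted edges must then
  meet at a single vertex.\<close>

lemma path_map_lgraph_inj:
  assumes "labeled_graph A \<Gamma>" "inj_on f (verts \<Gamma>)"
  shows "path (map_lgraph f \<Gamma>) (f p) w q' \<Longrightarrow> p \<in> verts \<Gamma> \<Longrightarrow> \<exists>q \<in> verts \<Gamma>. q' = f q \<and> path \<Gamma> p w q"
proof (induction w arbitrary: p)
  case (Cons x w)
  then obtain p1 q1 where 1: "step \<Gamma> p1 x q1" "f p1 = f p" "path (map_lgraph f \<Gamma>) (f q1) w q'"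
    by (auto simp: step_map_lgraph)
  moreover have "p1 = p"
    using inj_onD[OF assms(2) 1(2) stepD(1)[OF assms(1) 1(1)] Cons.prems(2)] .
  ultimately show ?case
    using Cons.IH[of q1] stepD[OF assms(1) 1(1)] by auto
qed auto

lemma path_loop_map_lgraph_inj:
  assumes "labeled_graph A \<Gamma>" "inj_on f (verts \<Gamma>)" "p \<in> verts \<Gamma>"
  shows "path (map_lgraph f \<Gamma>) (f p) w (f p) \<longleftrightarrow> path \<Gamma> p w p"
  using path_map_lgraph[of \<Gamma> p w p f] path_map_lgraph_inj[OF assms(1,2) _ assms(3), of w "f p"]
    inj_onD[OF assms(2) _ assms(3)] by blast

lemma finite_connected_graph_map:
  assumes "finite_connected_graph A \<Gamma>"
  shows "finite_connected_graph A (map_lgraph f \<Gamma>)"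
proof -
  have "labeled_graph A \<Gamma>" using assms by (simp add: finite_connected_graph_def labeled_graph_def)
  then have "edges (map_lgraph f \<Gamma>) \<subseteq> verts (map_lgraph f \<Gamma>) \<times> A \<times> verts (map_lgraph f \<Gamma>)"
    using labeled_graph_map unfolding labeled_graph_def by blast
  moreover have "finite (verts (map_lgraph f \<Gamma>))" "finite (edges (map_lgraph f \<Gamma>))"
    using assms by (simp_all add: finite_connected_graph_def map_lgraph_def)
  moreover have "\<exists>w. path (map_lgraph f \<Gamma>) p' w q'"
    if pq: "p' \<in> verts (map_lgraph f \<Gamma>)" "q' \<in> verts (map_lgraph f \<Gamma>)" for p' q'
  proof -
    obtain p q where "p' = f p" "q' = f q" "p \<in> verts \<Gamma>" "q \<in> verts \<Gamma>" using pq by auto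
    moreover from this obtain w where "path \<Gamma> p w q"
      using assms unfolding finite_connected_graph_def by blast
    ultimately show ?thesis
      using path_map_lgraph[of \<Gamma> p w q f] by blast
  qed
  ultimately show ?thesis unfolding finite_connected_graph_def by simp
qed

lemma stallingsI:
  assumes "finite_connected_graph A \<Gamma>" "b \<in> verts \<Gamma>" "deterministic \<Gamma>"
    "\<forall>p \<in> verts \<Gamma> - {b}. degree \<Gamma> p \<ge> 2"
  shows "stallings A \<Gamma> b {w \<in> carrier (free_group A). path \<Gamma> b w b}"
  using assms unfolding stallings_def deterministic_iff_edges
  by (elim conjE) (intro conjI refl; assumption)

text \<open>Folding can lower degrees, but never the number of distinct outgoing letters, which is the
  degree in a deterministic graph.\<close>

lemma stallings_map:
  assumes "stallings A \<Gamma> b H" "deterministic (map_lgraph f \<Gamma>)"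
  shows "stallings A (map_lgraph f \<Gamma>) (f b)
    {w \<in> carrier (free_group A). path (map_lgraph f \<Gamma>) (f b) w (f b)}"
proof -
  note G = stallingsD[OF assms(1)]
  have fin: "finite (edges (map_lgraph f \<Gamma>))"
    using G(4) by (simp add: map_lgraph_def)
  have deg: "\<forall>p' \<in> verts (map_lgraph f \<Gamma>) - {f b}. degree (map_lgraph f \<Gamma>) p' \<ge> 2"
  proof
    fix p' assume "p' \<in> verts (map_lgraph f \<Gamma>) - {f b}"
    then obtain p where p: "p' = f p" "p \<in> verts \<Gamma>" "p \<noteq> b" by auto
    then obtain x y where "x \<in> out_letters \<Gamma> p" "y \<in> out_letters \<Gamma> p" "x \<noteq> y"
      using G(7) degree_ge_2_iff[OF G(2,4)] by blast
    moreover have "out_letters \<Gamma> p \<subseteq> out_letters (map_lgraph f \<Gamma>) p'"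
      using p(1) by (auto simp: out_letters_def step_map_lgraph)
    ultimately show "degree (map_lgraph f \<Gamma>) p' \<ge> 2"
      using degree_ge_2_iff[OF assms(2) fin] by blast
  qed
  have "finite_connected_graph A \<Gamma>" using assms(1) by (simp add: stallings_def)
  then show ?thesis
    using stallingsI[OF finite_connected_graph_map _ assms(2) deg] G(5) by simp
qed

text \<open>Serves to move a Stallings graph from one vertex type to another, such as from cosets to
  natural numbers.\<close>

lemma stallings_map_inj:
  assumes "stallings A \<Gamma> b H" "inj_on f (verts \<Gamma>)"
  shows "stallings A (map_lgraph f \<Gamma>) (f b) H"
proof -
  note G = stallingsD[OF assms(1)]
  have "deterministic (map_lgraph f \<Gamma>)"
    unfolding deterministic_def
  proof (intro allI impI, elim conjE)
    fix p' x q1' q2'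
    assume "step (map_lgraph f \<Gamma>) p' x q1'" "step (map_lgraph f \<Gamma>) p' x q2'"
    then obtain p1 q1 p2 q2 where 1: "step \<Gamma> p1 x q1" "step \<Gamma> p2 x q2" "f p1 = f p2"
      and 2: "q1' = f q1" "q2' = f q2"
      by (auto simp: step_map_lgraph)
    have "p1 = p2"
      using inj_onD[OF assms(2) 1(3) stepD(1)[OF G(1) 1(1)] stepD(1)[OF G(1) 1(2)]] .
    then show "q1' = q2'" using 1(1,2) 2 deterministicD[OF G(2)] by blast
  qed
  from stallings_map[OF assms(1) this] show ?thesis
    unfolding path_loop_map_lgraph_inj[OF G(1) assms(2) G(5)] G(8)[symmetric] .
qed


section \<open>Morphisms to the Schreier graph\<close>

text \<open>A label-preserving morphism to the Schreier graph of \<open>K\<close>: its vertices are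
  the right cosets, and a letter acts by right multiplication. The base vertex is left free;
  \<open>\<phi> b = K\<close> is required separately where it matters.\<close>

definition coset_map ::
  "'a set \<Rightarrow> 'a word set \<Rightarrow> ('v, 'a) lgraph \<Rightarrow> ('v \<Rightarrow> 'a word set) \<Rightarrow> bool" where
  "coset_map A K \<Gamma> \<phi> \<longleftrightarrow>
     \<phi> ` verts \<Gamma> \<subseteq> rcosets\<^bsub>free_group A\<^esub> K \<and>
     (\<forall>p x q. step \<Gamma> p x q \<longrightarrow> \<phi> q = \<phi> p #>\<^bsub>free_group A\<^esub> [x])"

lemma coset_map_verts:
  assumes "coset_map A K \<Gamma> \<phi>" "subgroup K (free_group A)" "p \<in> verts \<Gamma>"
  obtains u where "u \<in> carrier (free_group A)" "\<phi> p = K #>\<^bsub>free_group A\<^esub> u"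
    "\<phi> p \<subseteq> carrier (free_group A)"
proof -
  have "\<phi> p \<in> rcosets\<^bsub>free_group A\<^esub> K"
    using assms(1,3) by (auto simp: coset_map_def)
  then obtain u where u: "u \<in> carrier (free_group A)" "\<phi> p = K #>\<^bsub>free_group A\<^esub> u"
    by (auto simp: RCOSETS_def)
  then have "\<phi> p \<subseteq> carrier (free_group A)"
    using monoid.r_coset_subset_G[OF group.is_monoid[OF group_free_group] subgroup.subset[OF assms(2)]]
    by simp
  from that[OF u this] show ?thesis .
qed

lemma coset_map_path:
  assumes "coset_map A K \<Gamma> \<phi>" "subgroup K (free_group A)" "labeled_graph A \<Gamma>"
  shows "path \<Gamma> p w q \<Longrightarrow> \<phi> q = \<phi> p #>\<^bsub>free_group A\<^esub> reduce w"
proof (induction w arbitrary: p)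
  case Nil
  then have p: "p \<in> verts \<Gamma>" "q = p" by auto
  obtain u where "\<phi> p \<subseteq> carrier (free_group A)"
    using coset_map_verts[OF assms(1,2) p(1)] by blast
  from group.coset_mult_one[OF group_free_group this] show ?case
    using p by simp
next
  case (Cons x w)
  then obtain r where r: "step \<Gamma> p x r" "path \<Gamma> r w q" by auto
  have w: "reduce w \<in> carrier (free_group A)"
    using reduce_in_carrier[OF path_letters[OF assms(3) r(2)]] .
  have x: "[x] \<in> carrier (free_group A)"
    using stepD(3)[OF assms(3) r(1)] by simp
  have p: "\<phi> p \<subseteq> carrier (free_group A)"
    by (rule coset_map_verts[OF assms(1,2) stepD(1)[OF assms(3) r(1)]])
  have "\<phi> r = \<phi> p #>\<^bsub>free_group A\<^esub> [x]"
    using r(1) assms(1) unfolding coset_map_def by blast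
  then have "\<phi> q = \<phi> p #>\<^bsub>free_group A\<^esub> [x] #>\<^bsub>free_group A\<^esub> reduce w"
    unfolding Cons.IH[OF r(2)] by (rule arg_cong)
  also have "\<dots> = \<phi> p #>\<^bsub>free_group A\<^esub> ([x] \<otimes>\<^bsub>free_group A\<^esub> reduce w)"
    by (rule group.coset_mult_assoc[OF group_free_group p x w])
  also have "[x] \<otimes>\<^bsub>free_group A\<^esub> reduce w = reduce (x # w)"
    using reduce_append_reduce_right[of "[x]" w] by (simp add: mult_free_group)
  finally show ?case .
qed

text \<open>A vertex is sent to the coset of any word leading to it from \<open>b\<close>; since
  \<open>H\<close> is contained in \<open>K\<close>, the choice of the word does not matter.\<close>

lemma stallings_coset_map:
  assumes "stallings A \<Gamma> b H" "H \<subseteq> K" "subgroup K (free_group A)"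
  obtains \<phi> where "coset_map A K \<Gamma> \<phi>" "\<phi> b = K"
proof -
  note G = stallingsD[OF assms(1)]
  let ?F = "free_group A"
  have K: "K \<subseteq> carrier ?F" by (rule subgroup.subset[OF assms(3)])
  define \<phi> where "\<phi> p = K #>\<^bsub>?F\<^esub> reduce (SOME w. path \<Gamma> b w p)" for p
  have \<phi>: "\<phi> p = K #>\<^bsub>?F\<^esub> reduce w" if "path \<Gamma> b w p" for w p
  proof -
    have "path \<Gamma> b (SOME w. path \<Gamma> b w p) p" using that by (rule someI)
    then show ?thesis
      unfolding \<phi>_def using stallings_rcoset_eq[OF assms(1) _ that assms(2,3)] by blast
  qed
  have "\<phi> b = K"
    using \<phi>[of "[]" b] G(5) group.coset_mult_one[OF group_free_group K] by simp
  moreover have "coset_map A K \<Gamma> \<phi>"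
    unfolding coset_map_def
  proof (intro conjI allI impI image_subsetI)
    fix p assume "p \<in> verts \<Gamma>"
    then obtain w where w: "path \<Gamma> b w p" using G(5,6) by blast
    show "\<phi> p \<in> rcosets\<^bsub>?F\<^esub> K"
      unfolding \<phi>[OF w]
      by (rule group.rcosetsI[OF group_free_group K reduce_in_carrier[OF path_letters[OF G(1) w]]])
  next
    fix p x q assume x: "step \<Gamma> p x q"
    then obtain w where w: "path \<Gamma> b w p" using G(5,6) stepD(1)[OF G(1)] by blast
    then have wx: "path \<Gamma> b (w @ [x]) q"
      using x path_append[OF G(1)] path_singleton[OF G(1)] by blast
    have "reduce (w @ [x]) = reduce w \<otimes>\<^bsub>?F\<^esub> [x]"
      by (simp add: mult_free_group)
    then show "\<phi> q = \<phi> p #>\<^bsub>?F\<^esub> [x]"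
      unfolding \<phi>[OF w] \<phi>[OF wx]
      using group.coset_mult_assoc[OF group_free_group K reduce_in_carrier[OF path_letters[OF G(1) w]]]
        stepD(3)[OF G(1) x] by simp
  qed
  ultimately show ?thesis using that by blast
qed

text \<open>A loop at \<open>b\<close> is mapped to a loop at the vertex \<open>K\<close> of the
  Schreier graph, and the labels of such loops reduce to elements of \<open>K\<close>.\<close>

lemma loop_in_subgroup:
  assumes "coset_map A K \<Gamma> \<phi>" "subgroup K (free_group A)" "labeled_graph A \<Gamma>"
    "\<phi> b = K" "path \<Gamma> b w b"
  shows "reduce w \<in> K"
proof -
  have "K #>\<^bsub>free_group A\<^esub> reduce w = K"
    using coset_map_path[OF assms(1-3,5), symmetric] assms(4) by simp
  from group.coset_join1[OF group_free_group this
      reduce_in_carrier[OF path_letters[OF assms(3,5)]] assms(2)]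
  show ?thesis .
qed

text \<open>A common word \<open>u\<close> leads from \<open>p\<close> and \<open>q\<close> to
  vertices with a common nontrivial loop label, whose images coincide by malnormality. Going back
  along \<open>u\<close> in the Schreier graph identifies the images of \<open>p\<close> and
  \<open>q\<close>.\<close>

lemma coset_map_infinite_pairs:
  assumes "stallings A \<Gamma> b H" "finite A" "malnormal (free_group A) K" "coset_map A K \<Gamma> \<phi>"
    "(p, q) \<in> infinite_pairs \<Gamma> b"
  shows "\<phi> p = \<phi> q"
proof -
  note G = stallingsD[OF assms(1)]
  let ?F = "free_group A"
  have K: "subgroup K ?F" using assms(3) by (simp add: malnormal_def)
  note path = coset_map_path[OF assms(4) K G(1)]
  obtain u c p' q' where 1: "path \<Gamma> p u p'" "path \<Gamma> q u q'" "path \<Gamma> p' c p'" "path \<Gamma> q' c q'"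
    and c: "reduced c" "c \<noteq> []"
    by (rule infinite_pair_loop[OF assms(1,2,5)])
  have cF: "c \<in> carrier ?F"
    using c path_letters[OF G(1) 1(3)] by (simp add: carrier_free_group)
  have loop: "s \<otimes>\<^bsub>?F\<^esub> c \<otimes>\<^bsub>?F\<^esub> inv\<^bsub>?F\<^esub> s \<in> K"
    if "path \<Gamma> r c r" "\<phi> r = K #>\<^bsub>?F\<^esub> s" "s \<in> carrier ?F" for r s
  proof -
    have "K #>\<^bsub>?F\<^esub> s #>\<^bsub>?F\<^esub> c = K #>\<^bsub>?F\<^esub> s"
      using path[OF that(1), symmetric] that(2) c by (simp add: reduce_reduced)
    then have "K #>\<^bsub>?F\<^esub> (s \<otimes>\<^bsub>?F\<^esub> c) = K #>\<^bsub>?F\<^esub> s"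
      using group.coset_mult_assoc[OF group_free_group subgroup.subset[OF K] that(3) cF] by simp
    moreover have "s \<otimes>\<^bsub>?F\<^esub> c \<in> carrier ?F"
      using monoid.m_closed[OF group.is_monoid[OF group_free_group] that(3) cF] .
    ultimately show ?thesis
      using rcoset_eq_iff[OF group_free_group K _ that(3)] by simp
  qed
  obtain s where s: "s \<in> carrier ?F" "\<phi> p' = K #>\<^bsub>?F\<^esub> s"
    by (rule coset_map_verts[OF assms(4) K path_verts(1)[OF G(1) 1(3)]])
  obtain t where t: "t \<in> carrier ?F" "\<phi> q' = K #>\<^bsub>?F\<^esub> t"
    by (rule coset_map_verts[OF assms(4) K path_verts(1)[OF G(1) 1(4)]])
  have "c \<noteq> \<one>\<^bsub>?F\<^esub>" using c(2) by simp
  from malnormal_rcoset_eq[OF group_free_group assms(3) s(1) t(1) cF this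
      loop[OF 1(3) s(2,1)] loop[OF 1(4) t(2,1)]]
  have "\<phi> p' = \<phi> q'" unfolding s(2) t(2) .
  then show ?thesis
    unfolding path[OF path_inv_word[OF G(1) 1(1)]] path[OF path_inv_word[OF G(1) 1(2)]] by simp
qed


section \<open>Identification and reduction\<close>

lemma coset_map_map_lgraph:
  assumes "labeled_graph A \<Gamma>" "coset_map A K \<Gamma> \<phi>"
    "\<And>p q. p \<in> verts \<Gamma> \<Longrightarrow> q \<in> verts \<Gamma> \<Longrightarrow> f p = f q \<Longrightarrow> \<phi> p = \<phi> q"
  obtains \<psi> where "coset_map A K (map_lgraph f \<Gamma>) \<psi>" "\<And>p. p \<in> verts \<Gamma> \<Longrightarrow> \<psi> (f p) = \<phi> p"
proof -
  \<comment> \<open>Any representative of a fibre of \<open>f\<close> will do, because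
    \<open>\<phi>\<close> is constant on fibres.\<close>
  define \<psi> where "\<psi> = \<phi> \<circ> inv_into (verts \<Gamma>) f"
  have \<psi>: "\<psi> (f p) = \<phi> p" if "p \<in> verts \<Gamma>" for p
    using that assms(3)[of "inv_into (verts \<Gamma>) f (f p)" p]
    by (simp add: \<psi>_def inv_into_into f_inv_into_f)
  have "coset_map A K (map_lgraph f \<Gamma>) \<psi>"
    using assms(2) \<psi> stepD(1,2)[OF assms(1)] unfolding coset_map_def step_map_lgraph
    by (auto simp: image_subset_iff)
  with \<psi> that show ?thesis by blast
qed

text \<open>The universal property of the quotient by \<open>R\<close>, tested on Schreier graphs only.\<close>

definition quotient_map ::
  "'a set \<Rightarrow> ('v \<times> 'v) set \<Rightarrow> ('v \<Rightarrow> 'w) \<Rightarrow> ('v, 'a) lgraph \<Rightarrow> bool" where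
  "quotient_map A R f \<Gamma> \<longleftrightarrow> (\<forall>K \<phi>. coset_map A K \<Gamma> \<phi> \<and> (\<forall>(p, q) \<in> R. \<phi> p = \<phi> q) \<longrightarrow>
     (\<forall>p \<in> verts \<Gamma>. \<forall>q \<in> verts \<Gamma>. f p = f q \<longrightarrow> \<phi> p = \<phi> q))"

lemma identifies_map:
  assumes "identifies R \<Gamma> b \<Gamma>' b'" "R \<subseteq> verts \<Gamma> \<times> verts \<Gamma>"
  obtains f where "\<Gamma>' = map_lgraph f \<Gamma>" "b' = f b" "quotient_map A R f \<Gamma>"
    "\<And>p q. (p, q) \<in> R \<Longrightarrow> f p = f q"
proof -
  obtain f where f: "\<forall>p \<in> verts \<Gamma>. \<forall>q \<in> verts \<Gamma>. f p = f q \<longleftrightarrow> (p, q) \<in> (R \<union> R\<inverse>)\<^sup>*"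
    "\<Gamma>' = map_lgraph f \<Gamma>" "b' = f b"
    using assms(1) unfolding identifies_def by blast
  have "quotient_map A R f \<Gamma>"
    unfolding quotient_map_def
  proof (intro allI impI ballI)
    fix K \<phi> p q
    assume \<phi>: "coset_map A K \<Gamma> \<phi> \<and> (\<forall>(p, q) \<in> R. \<phi> p = \<phi> q)"
      and "p \<in> verts \<Gamma>" "q \<in> verts \<Gamma>" "f p = f q"
    then have "(p, q) \<in> (R \<union> R\<inverse>)\<^sup>*" using f(1) by blast
    then show "\<phi> p = \<phi> q"
      by (induction rule: rtrancl_induct) (use \<phi> in auto)
  qed
  moreover have "f p = f q" if "(p, q) \<in> R" for p q
    using f(1) assms(2) that by blast
  ultimately show ?thesis using that f by blast
qed

text \<open>A morphism respecting \<open>R\<close> factors through \<open>f\<close>, and the factor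
  in turn is constant on the fibres of \<open>g\<close>. The last hypothesis says that every
  morphism respects \<open>S\<close>, so the composite is governed by \<open>R\<close>
  alone.\<close>

lemma quotient_map_comp:
  assumes "labeled_graph A \<Gamma>" "quotient_map A R f \<Gamma>" "quotient_map A S g (map_lgraph f \<Gamma>)"
    "\<And>K \<psi>. coset_map A K (map_lgraph f \<Gamma>) \<psi> \<Longrightarrow> \<forall>(p, q) \<in> S. \<psi> p = \<psi> q"
  shows "quotient_map A R (g \<circ> f) \<Gamma>"
  unfolding quotient_map_def
proof (intro allI impI ballI)
  fix K \<phi> p q
  assume \<phi>: "coset_map A K \<Gamma> \<phi> \<and> (\<forall>(p, q) \<in> R. \<phi> p = \<phi> q)"
    and pq: "p \<in> verts \<Gamma>" "q \<in> verts \<Gamma>" "(g \<circ> f) p = (g \<circ> f) q"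
  have "\<phi> p = \<phi> q" if "p \<in> verts \<Gamma>" "q \<in> verts \<Gamma>" "f p = f q" for p q
    using assms(2) \<phi> that unfolding quotient_map_def by blast
  then obtain \<psi> where \<psi>: "coset_map A K (map_lgraph f \<Gamma>) \<psi>" "\<And>p. p \<in> verts \<Gamma> \<Longrightarrow> \<psi> (f p) = \<phi> p"
    using coset_map_map_lgraph[OF assms(1)] \<phi> by metis
  have "\<psi> (f p) = \<psi> (f q)"
    using assms(3) assms(4)[OF \<psi>(1)] \<psi>(1) pq unfolding quotient_map_def by simp
  then show "\<phi> p = \<phi> q" using \<psi>(2) pq by simp
qed

text \<open>Every morphism to a Schreier graph already merges a foldable pair, because both images
  are the same coset multiplied by the same letter.\<close>

lemma foldableD:
  assumes "labeled_graph A \<Gamma>" "foldable \<Gamma> p p'"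
  shows "p \<noteq> p'" "p \<in> verts \<Gamma>" "p' \<in> verts \<Gamma>" "coset_map A K \<Gamma> \<phi> \<Longrightarrow> \<phi> p = \<phi> p'"
  using assms(2) stepD[OF assms(1)] unfolding foldable_def coset_map_def by (blast, blast, blast, metis)

text \<open>Foldings are forced on every morphism to a Schreier graph, so their composite has the
  universal property for the empty relation.\<close>

lemma reduces_to_map:
  assumes "reduces_to \<Gamma> b \<Gamma>' b'" "labeled_graph A \<Gamma>"
  shows "\<exists>f. \<Gamma>' = map_lgraph f \<Gamma> \<and> b' = f b \<and> deterministic \<Gamma>' \<and> quotient_map A {} f \<Gamma>"
  using assms
proof (induction rule: reduces_to.induct)
  case (stop \<Gamma> b)
  then show ?case
    by (intro exI[of _ "\<lambda>p. p"]) (auto simp: deterministic_iff_not_foldable quotient_map_def)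
next
  case (fold \<Gamma> p p' b \<Gamma>' b' \<Gamma>'' b'')
  note pp' = foldableD[OF fold.prems fold.hyps(1)]
  obtain f where f: "\<Gamma>' = map_lgraph f \<Gamma>" "b' = f b" "quotient_map A {(p, p')} f \<Gamma>"
    using identifies_map[OF fold.hyps(2)] pp'(2,3) by blast
  then have "labeled_graph A \<Gamma>'" using fold.prems labeled_graph_map by blast
  then obtain g where g: "\<Gamma>'' = map_lgraph g \<Gamma>'" "b'' = g b'" "deterministic \<Gamma>''" "quotient_map A {} g \<Gamma>'"
    using fold.IH by blast
  have "quotient_map A {} f \<Gamma>"
    using f(3) pp'(4) unfolding quotient_map_def by blast
  from quotient_map_comp[OF fold.prems this g(4)[unfolded f(1)]] show ?case
    using f(1,2) g(1-3)
    by (intro exI[of _ "g \<circ> f"]) (simp add: map_lgraph_map_lgraph[unfolded comp_def] comp_def)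
qed

lemma infinite_pairs_verts: "infinite_pairs \<Gamma> b \<subseteq> verts \<Gamma> \<times> verts \<Gamma>"
  using verts_core[of \<Gamma> b] by (auto simp: infinite_pairs_def)

lemma construction_map:
  assumes "construction \<Gamma> b \<Gamma>' b'" "labeled_graph A \<Gamma>"
  obtains f where "\<Gamma>' = map_lgraph f \<Gamma>" "b' = f b" "deterministic \<Gamma>'"
    "quotient_map A (infinite_pairs \<Gamma> b) f \<Gamma>" "\<And>p q. (p, q) \<in> infinite_pairs \<Gamma> b \<Longrightarrow> f p = f q"
proof -
  obtain \<Delta> d where \<Delta>: "identifies (infinite_pairs \<Gamma> b) \<Gamma> b \<Delta> d" "reduces_to \<Delta> d \<Gamma>' b'"
    using assms(1) unfolding construction_def by blast
  obtain f where f: "\<Delta> = map_lgraph f \<Gamma>" "d = f b" "quotient_map A (infinite_pairs \<Gamma> b) f \<Gamma>"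
    "\<And>p q. (p, q) \<in> infinite_pairs \<Gamma> b \<Longrightarrow> f p = f q"
    by (rule identifies_map[where A = A, OF \<Delta>(1) infinite_pairs_verts]) blast
  have "labeled_graph A \<Delta>" using f(1) assms(2) labeled_graph_map by blast
  then obtain g where g: "\<Gamma>' = map_lgraph g \<Delta>" "b' = g d" "deterministic \<Gamma>'" "quotient_map A {} g \<Delta>"
    using reduces_to_map[OF \<Delta>(2)] by blast
  show ?thesis
  proof (rule that[of "g \<circ> f"])
    show "quotient_map A (infinite_pairs \<Gamma> b) (g \<circ> f) \<Gamma>"
      by (rule quotient_map_comp[OF assms(2) f(3) g(4)[unfolded f(1)]]) simp
    show "\<Gamma>' = map_lgraph (g \<circ> f) \<Gamma>" "b' = (g \<circ> f) b"
      using f(1,2) g(1,2) by (simp_all add: map_lgraph_map_lgraph)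
    show "(g \<circ> f) p = (g \<circ> f) q" if "(p, q) \<in> infinite_pairs \<Gamma> b" for p q
      using f(4)[OF that] by simp
  qed (rule g(3))
qed

section \<open>Existence of quotients, reductions and steps of the construction\<close>

lemma identifies_exists:
  fixes \<Gamma> :: "('v, 'a) lgraph"
  obtains \<Gamma>' :: "('v, 'a) lgraph" and b' where "identifies R \<Gamma> b \<Gamma>' b'"
proof -
  \<comment> \<open>Choosing one representative per class keeps the quotient over the same vertex
    type.\<close>
  define f where "f p = (SOME q. (p, q) \<in> (R \<union> R\<inverse>)\<^sup>*)" for p
  have sym: "sym ((R \<union> R\<inverse>)\<^sup>*)" by (rule sym_rtrancl) (auto simp: sym_def)
  have f: "(p, f p) \<in> (R \<union> R\<inverse>)\<^sup>*" for p
    unfolding f_def by (rule someI[of _ p]) simp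
  have "f p = f q \<longleftrightarrow> (p, q) \<in> (R \<union> R\<inverse>)\<^sup>*" for p q
  proof
    assume "f p = f q"
    then show "(p, q) \<in> (R \<union> R\<inverse>)\<^sup>*"
      using rtrancl_trans[OF f[of p]] symD[OF sym f[of q]] by simp
  next
    assume pq: "(p, q) \<in> (R \<union> R\<inverse>)\<^sup>*"
    then have "(p, r) \<in> (R \<union> R\<inverse>)\<^sup>* \<longleftrightarrow> (q, r) \<in> (R \<union> R\<inverse>)\<^sup>*" for r
      using rtrancl_trans[OF pq] rtrancl_trans[OF symD[OF sym pq]] by auto
    then show "f p = f q" by (simp add: f_def)
  qed
  then have "identifies R \<Gamma> b (map_lgraph f \<Gamma>) (f b)" unfolding identifies_def by blast
  with that show ?thesis .
qed

text \<open>Each folding merges two distinct vertices, so the number of vertices drops and the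
  process ends.\<close>

lemma reduces_to_exists:
  fixes \<Gamma> :: "('v, 'a) lgraph"
  shows "\<lbrakk>labeled_graph A \<Gamma>; finite (verts \<Gamma>)\<rbrakk> \<Longrightarrow> \<exists>\<Gamma>' b'. reduces_to \<Gamma> b \<Gamma>' b'"
proof (induction "card (verts \<Gamma>)" arbitrary: \<Gamma> b rule: less_induct)
  case less
  show ?case
  proof (cases "\<exists>p p'. foldable \<Gamma> p p'")
    case False
    then have "reduces_to \<Gamma> b \<Gamma> b" by (intro reduces_to.stop) blast
    then show ?thesis by blast
  next
    case True
    then obtain p p' where fold: "foldable \<Gamma> p p'" by blast
    note pp' = foldableD[OF less.prems(1) fold]
    obtain \<Gamma>1 :: "('v, 'a) lgraph" and b1 where 1: "identifies {(p, p')} \<Gamma> b \<Gamma>1 b1"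
      by (rule identifies_exists)
    have "{(p, p')} \<subseteq> verts \<Gamma> \<times> verts \<Gamma>" using pp'(2,3) by simp
    then obtain f where f: "\<Gamma>1 = map_lgraph f \<Gamma>" "f p = f p'"
      by (rule identifies_map[where A = A, OF 1]) blast
    have "\<not> inj_on f (verts \<Gamma>)" using pp'(1-3) f(2) unfolding inj_on_def by blast
    then have "card (f ` verts \<Gamma>) \<noteq> card (verts \<Gamma>)"
      using less.prems(2) eq_card_imp_inj_on by blast
    then have "card (verts \<Gamma>1) < card (verts \<Gamma>)"
      using f(1) card_image_le[OF less.prems(2), of f] by simp
    then obtain \<Gamma>' b' where "reduces_to \<Gamma>1 b1 \<Gamma>' b'"
      using less.hyps[of \<Gamma>1 b1] f(1) less.prems labeled_graph_map by fastforce
    then show ?thesis using reduces_to.fold[OF fold 1] by blast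
  qed
qed

lemma construction_exists:
  fixes \<Gamma> :: "('v, 'a) lgraph"
  assumes "stallings A \<Gamma> b H"
  obtains \<Gamma>' :: "('v, 'a) lgraph" and b' H' where "construction \<Gamma> b \<Gamma>' b'" "stallings A \<Gamma>' b' H'"
proof -
  note G = stallingsD[OF assms]
  obtain \<Delta> :: "('v, 'a) lgraph" and d where 1: "identifies (infinite_pairs \<Gamma> b) \<Gamma> b \<Delta> d"
    by (rule identifies_exists)
  obtain f where "\<Delta> = map_lgraph f \<Gamma>" by (rule identifies_map[where A = A, OF 1 infinite_pairs_verts])
  then obtain \<Gamma>' b' where "reduces_to \<Delta> d \<Gamma>' b'"
    using reduces_to_exists[of A \<Delta>] G(1,3) labeled_graph_map by fastforce
  with 1 have c: "construction \<Gamma> b \<Gamma>' b'" unfolding construction_def by blast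
  obtain f where f: "\<Gamma>' = map_lgraph f \<Gamma>" "b' = f b" "deterministic \<Gamma>'"
    by (rule construction_map[OF c G(1)]) blast
  show ?thesis
    using that[OF c] stallings_map[OF assms f(3)[unfolded f(1)]] f(1,2) by simp
qed

section \<open>Effect of one step on the subgroup and on the number of vertices\<close>

lemma construction_subset:
  assumes "stallings A \<Gamma> b H" "stallings A \<Gamma>' b' H'" "construction \<Gamma> b \<Gamma>' b'"
  shows "H \<subseteq> H'"
proof -
  note G = stallingsD[OF assms(1)] and G' = stallingsD[OF assms(2)]
  obtain f where "\<Gamma>' = map_lgraph f \<Gamma>" "b' = f b"
    by (rule construction_map[OF assms(3) G(1)]) blast
  then show ?thesis
    unfolding G(8) G'(8) using path_map_lgraph[of \<Gamma> b _ b f] by auto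
qed

text \<open>The morphism to the Schreier graph of \<open>K\<close> merges everything that the step
  merges, so it descends to \<open>\<Gamma>'\<close>, and loops at \<open>b'\<close> still spell
  elements of \<open>K\<close>.\<close>

lemma construction_subset_malnormal:
  assumes "stallings A \<Gamma> b H" "stallings A \<Gamma>' b' H'" "construction \<Gamma> b \<Gamma>' b'" "finite A"
    and "malnormal (free_group A) K" "H \<subseteq> K"
  shows "H' \<subseteq> K"
proof
  note G = stallingsD[OF assms(1)] and G' = stallingsD[OF assms(2)]
  have K: "subgroup K (free_group A)" using assms(5) by (simp add: malnormal_def)
  obtain f where f: "\<Gamma>' = map_lgraph f \<Gamma>" "b' = f b" "quotient_map A (infinite_pairs \<Gamma> b) f \<Gamma>"
    by (rule construction_map[OF assms(3) G(1)]) blast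
  obtain \<phi> where \<phi>: "coset_map A K \<Gamma> \<phi>" "\<phi> b = K"
    by (rule stallings_coset_map[OF assms(1,6) K])
  have "\<forall>(p, q) \<in> infinite_pairs \<Gamma> b. \<phi> p = \<phi> q"
    using coset_map_infinite_pairs[OF assms(1,4,5) \<phi>(1)] by auto
  then have "\<forall>p \<in> verts \<Gamma>. \<forall>q \<in> verts \<Gamma>. f p = f q \<longrightarrow> \<phi> p = \<phi> q"
    using f(3) \<phi>(1) unfolding quotient_map_def by blast
  then obtain \<psi> where \<psi>: "coset_map A K \<Gamma>' \<psi>" "\<And>p. p \<in> verts \<Gamma> \<Longrightarrow> \<psi> (f p) = \<phi> p"
    unfolding f(1) by (rule_tac coset_map_map_lgraph[OF G(1) \<phi>(1), of f]) blast+
  fix w assume "w \<in> H'"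
  then have w: "reduced w" "path \<Gamma>' b' w b'" using G'(8) by (auto simp: carrier_free_group)
  have "\<psi> b' = K" using \<psi>(2)[OF G(5)] \<phi>(2) f(2) by simp
  from loop_in_subgroup[OF \<psi>(1) K G'(1) this w(2)] show "w \<in> K"
    using w(1) by (simp add: reduce_reduced)
qed

text \<open>If no vertex is lost, the map of the step is injective: it cannot have merged an
  infinite pair, and it leaves the loop labels at the base unchanged.\<close>

lemma construction_card:
  assumes "stallings A \<Gamma> b H" "stallings A \<Gamma>' b' H'" "construction \<Gamma> b \<Gamma>' b'"
  shows "card (verts \<Gamma>') \<le> card (verts \<Gamma>)"
    and "card (verts \<Gamma>') = card (verts \<Gamma>) \<Longrightarrow> infinite_pairs \<Gamma> b = {} \<and> H' = H"
proof -
  note G = stallingsD[OF assms(1)] and G' = stallingsD[OF assms(2)]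
  obtain f where f: "\<Gamma>' = map_lgraph f \<Gamma>" "b' = f b" "\<And>p q. (p, q) \<in> infinite_pairs \<Gamma> b \<Longrightarrow> f p = f q"
    by (rule construction_map[OF assms(3) G(1)]) blast
  show "card (verts \<Gamma>') \<le> card (verts \<Gamma>)"
    using f(1) G(3) by (simp add: card_image_le)
  assume "card (verts \<Gamma>') = card (verts \<Gamma>)"
  then have inj: "inj_on f (verts \<Gamma>)" using f(1) G(3) by (simp add: eq_card_imp_inj_on)
  have "infinite_pairs \<Gamma> b = {}"
  proof (rule ccontr)
    assume "infinite_pairs \<Gamma> b \<noteq> {}"
    then obtain p q where pq: "(p, q) \<in> infinite_pairs \<Gamma> b" by auto
    then have "p \<in> verts \<Gamma>" "q \<in> verts \<Gamma>" using infinite_pairs_verts[of \<Gamma> b] by auto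
    then have "p = q" using inj_onD[OF inj f(3)[OF pq]] by simp
    then show False using pq by (simp add: infinite_pairs_def)
  qed
  moreover have "H' = H"
    unfolding G(8) G'(8) f(1,2) using path_loop_map_lgraph_inj[OF G(1) inj G(5)] by blast
  ultimately show "infinite_pairs \<Gamma> b = {} \<and> H' = H" ..
qed


section \<open>Existence of Stallings graphs\<close>

text \<open>The Stallings graph is found inside the Schreier graph of \<open>H\<close>: it is spanned by the loops at
  \<open>H\<close> labeled by generators, so no folding is needed.\<close>

lemma stallings_exists:
  assumes "finite A" "finitely_generated (free_group A) H"
  obtains \<Gamma> :: "(nat, 'a) lgraph" and b where "stallings A \<Gamma> b H"
proof -
  let ?F = "free_group A"
  interpret group ?F by (rule group_free_group)
  obtain S where S: "S \<subseteq> carrier ?F" "finite S" "H = generate ?F S"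
    using assms(2) unfolding finitely_generated_def by blast
  have H: "subgroup H ?F" unfolding S(3) by (rule generate_is_subgroup[OF S(1)])
  have Hsub: "H \<subseteq> carrier ?F" by (rule subgroup.subset[OF H])
  define C where "C u = H #>\<^bsub>?F\<^esub> reduce u" for u
  \<comment> \<open>The letter positions of the generators: \<open>x\<close> is read after the
    prefix \<open>u\<close>.\<close>
  define E where "E = {(u, x). \<exists>v. u @ x # v \<in> S}"
  \<comment> \<open>Inserting \<open>H\<close> provides the base vertex even if the generators
    contain no letters.\<close>
  define V where "V = insert H (\<Union>(u, x) \<in> E. {C u, C (u @ [x])})"
  define \<Delta> :: "('a word set, 'a) lgraph" where "\<Delta> =
    \<lparr>verts = V,
     edges = {(C u, a, C (u @ [Pos a])) | u a. (u, Pos a) \<in> E} \<union>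
             {(C (u @ [Neg a]), a, C u) | u a. (u, Neg a) \<in> E}\<rparr>"
  have S_letters: "reduced s" "set s \<subseteq> letters A" if "s \<in> S" for s
    using that S(1) carrier_free_group[of s A] by auto
  have E: "set u \<subseteq> letters A" "x \<in> letters A" if "(u, x) \<in> E" for u x
    using that S_letters(2) unfolding E_def by fastforce+
  have C_Nil: "C [] = H"
    using coset_mult_one[OF Hsub] by (simp add: C_def)
  have C_append: "C u #>\<^bsub>?F\<^esub> reduce v = C (u @ v)" if "set u \<subseteq> letters A" "set v \<subseteq> letters A" for u v
    unfolding C_def
    using coset_mult_assoc[OF Hsub reduce_in_carrier[OF that(1)] reduce_in_carrier[OF that(2)]]
    by (simp add: mult_free_group)
  have C_S: "C s = H" if "s \<in> S" for s
  proof -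
    have "s \<in> H" using that S(3) generate.incl by metis
    then show ?thesis
      unfolding C_def using S_letters[OF that] coset_join2[OF _ H] Hsub by (auto simp: reduce_reduced)
  qed
  have edge: "step \<Delta> p x q \<longleftrightarrow> (\<exists>u. (u, x) \<in> E \<and> p = C u \<and> q = C (u @ [x]) \<or>
      (u, bar x) \<in> E \<and> p = C (u @ [bar x]) \<and> q = C u)" for p x q
    by (cases x) (auto simp: \<Delta>_def)
  have fin_E: "finite E"
  proof (rule finite_subset)
    show "E \<subseteq> (\<Union>s \<in> S. (\<lambda>i. (take i s, s ! i)) ` {..length s})"
    proof (clarify, unfold E_def mem_Collect_eq prod.case, elim exE)
      fix u x v assume "u @ x # v \<in> S"
      moreover have "(u, x) \<in> (\<lambda>i. (take i (u @ x # v), (u @ x # v) ! i)) ` {..length (u @ x # v)}"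
        by (rule image_eqI[of _ _ "length u"]) auto
      ultimately show "(u, x) \<in> (\<Union>s \<in> S. (\<lambda>i. (take i s, s ! i)) ` {..length s})" by blast
    qed
  qed (use S(2) in blast)
  have E_verts: "C u \<in> V" "C (u @ [x]) \<in> V" if "(u, x) \<in> E" for u x
    using that unfolding V_def by auto
  have lab: "labeled_graph A \<Delta>"
    unfolding labeled_graph_def
  proof
    fix e assume "e \<in> edges \<Delta>"
    then consider u a where "e = (C u, a, C (u @ [Pos a]))" "(u, Pos a) \<in> E"
      | u a where "e = (C (u @ [Neg a]), a, C u)" "(u, Neg a) \<in> E"
      unfolding \<Delta>_def by auto
    then show "e \<in> verts \<Delta> \<times> A \<times> verts \<Delta>"
    proof cases
      case (1 u a)
      then show ?thesis using E_verts[OF 1(2)] E(2)[OF 1(2)] by (auto simp: \<Delta>_def letters_def)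
    next
      case (2 u a)
      then show ?thesis using E_verts[OF 2(2)] E(2)[OF 2(2)] by (auto simp: \<Delta>_def letters_def)
    qed
  qed
  have fin: "finite (verts \<Delta>)" "finite (edges \<Delta>)"
  proof -
    show "finite (verts \<Delta>)" using fin_E by (auto simp: \<Delta>_def V_def)
    then have "finite (verts \<Delta> \<times> A \<times> verts \<Delta>)" using assms(1) by blast
    then show "finite (edges \<Delta>)" using lab finite_subset unfolding labeled_graph_def by metis
  qed
  \<comment> \<open>Every edge is an edge of the Schreier graph; determinism is inherited from
    there.\<close>
  have step_C: "q = p #>\<^bsub>?F\<^esub> [x]" if pq: "step \<Delta> p x q" for p x q
  proof -
    obtain u where "(u, x) \<in> E \<and> p = C u \<and> q = C (u @ [x]) \<or>
      (u, bar x) \<in> E \<and> p = C (u @ [bar x]) \<and> q = C u"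
      using iffD1[OF edge pq] by blast
    then show ?thesis
    proof (elim disjE conjE)
      assume "(u, x) \<in> E" "p = C u" "q = C (u @ [x])"
      then show ?thesis using C_append[of u "[x]"] E[of u x] by (simp add: reduce_reduced)
    next
      assume 1: "(u, bar x) \<in> E" "p = C (u @ [bar x])" "q = C u"
      then have "p #>\<^bsub>?F\<^esub> [x] = C (u @ [bar x] @ [x])"
        using C_append[of "u @ [bar x]" "[x]"] E[of u "bar x"] bar_mem_letters[of "bar x" A]
        by (simp add: reduce_reduced)
      also have "\<dots> = C u"
        using reduce_cancel_pair[of u "bar x" "[]"] by (simp add: C_def)
      finally show ?thesis using 1 by simp
    qed
  qed
  have det: "deterministic \<Delta>"
    unfolding deterministic_def using step_C by blast
  have path_prefix: "path \<Delta> H u (C u)" if "u @ v \<in> S" for u v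
    using that
  proof (induction u arbitrary: v rule: rev_induct)
    case Nil
    then show ?case by (simp add: C_Nil \<Delta>_def V_def)
  next
    case (snoc x u)
    then have "(u, x) \<in> E" by (auto simp: E_def)
    then have "step \<Delta> (C u) x (C (u @ [x]))" unfolding edge by blast
    moreover have "path \<Delta> H u (C u)" using snoc.IH[of "x # v"] snoc.prems by simp
    ultimately show ?case unfolding path_append[OF lab] path_singleton[OF lab] by blast
  qed
  have reach: "\<exists>w. path \<Delta> H w p" if "p \<in> verts \<Delta>" for p
  proof -
    have "p = H \<or> (\<exists>u x. (u, x) \<in> E \<and> (p = C u \<or> p = C (u @ [x])))"
      using that by (auto simp: \<Delta>_def V_def)
    then show ?thesis
    proof (elim disjE exE conjE)
      assume "p = H"
      then have "path \<Delta> H [] p" by (simp add: \<Delta>_def V_def)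
      then show ?thesis ..
    next
      fix u x assume "(u, x) \<in> E" "p = C u"
      then show ?thesis using path_prefix unfolding E_def by blast
    next
      fix u x assume "(u, x) \<in> E" "p = C (u @ [x])"
      then show ?thesis using path_prefix[of "u @ [x]"] unfolding E_def by auto
    qed
  qed
  have conn: "finite_connected_graph A \<Delta>"
    unfolding finite_connected_graph_def
  proof (intro conjI ballI)
    fix p q assume "p \<in> verts \<Delta>" "q \<in> verts \<Delta>"
    then obtain u v where "path \<Delta> H u p" "path \<Delta> H v q" using reach by blast
    then have "path \<Delta> p (inv_word u @ v) q"
      using path_inv_word[OF lab] path_append[OF lab] by blast
    then show "\<exists>w. path \<Delta> p w q" ..
  qed (use fin lab in \<open>simp_all add: labeled_graph_def\<close>)
  \<comment> \<open>Inside a generator one can leave backwards by \<open>bar x\<close> and forwards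
    by \<open>y\<close>; these differ because the generator is reduced.\<close>
  have two_letters: "\<exists>x \<in> out_letters \<Delta> (C u). \<exists>y \<in> out_letters \<Delta> (C u). x \<noteq> y"
    if uv: "u @ v \<in> S" "u \<noteq> []" "v \<noteq> []" for u v
  proof -
    obtain u' x where u: "u = u' @ [x]" using uv(2) by (meson rev_exhaust)
    obtain y v' where v: "v = y # v'" using uv(3) by (meson list.exhaust)
    have "(u', x) \<in> E" "(u, y) \<in> E" using uv(1) u v by (auto simp: E_def)
    then have "step \<Delta> (C u) (bar x) (C u')" "step \<Delta> (C u) y (C (u @ [y]))"
      unfolding edge u by auto
    moreover have "y \<noteq> bar x"
      using S_letters(1)[OF uv(1)] u v by (simp add: reduced_append reduced_Cons)
    ultimately show ?thesis unfolding out_letters_def by blast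
  qed
  have deg: "\<forall>p \<in> verts \<Delta> - {H}. degree \<Delta> p \<ge> 2"
  proof
    fix p assume "p \<in> verts \<Delta> - {H}"
    then have p: "p \<noteq> H" "p \<in> V" by (auto simp: \<Delta>_def)
    then obtain u x where ux: "(u, x) \<in> E" "p = C u \<or> p = C (u @ [x])"
      unfolding V_def by auto
    then obtain v where v: "u @ x # v \<in> S" by (auto simp: E_def)
    \<comment> \<open>Each vertex is the coset of a prefix of a generator. The empty prefix and the
      full generator both give \<open>H\<close>, so for any other vertex the position is an inner
      one.\<close>
    have "\<exists>u v. u @ v \<in> S \<and> p = C u"
      using ux(2)
    proof
      assume "p = C (u @ [x])"
      then show ?thesis using v by (intro exI[of _ "u @ [x]"] exI[of _ v]) simp
    qed (use v in blast)
    then obtain u v where uv: "u @ v \<in> S" "p = C u" by blast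
    have "u \<noteq> []" using p(1) uv(2) C_Nil by auto
    moreover have "v \<noteq> []" using p(1) uv C_S by auto
    ultimately show "degree \<Delta> p \<ge> 2"
      using two_letters[OF uv(1)] degree_ge_2_iff[OF det fin(2)] uv(2) by simp
  qed
  have HV: "H \<in> verts \<Delta>" by (simp add: \<Delta>_def V_def)
  let ?L = "{w \<in> carrier ?F. path \<Delta> H w H}"
  note st = stallingsI[OF conn HV det deg]
  have "?L = H"
  proof
    \<comment> \<open>The inclusion into the Schreier graph shows that loops at \<open>H\<close> lie
      in \<open>H\<close>; conversely, the generators label such loops.\<close>
    have "coset_map A H \<Delta> id"
      unfolding coset_map_def
    proof (intro conjI allI impI)
      have "C u \<in> rcosets\<^bsub>?F\<^esub> H" if "set u \<subseteq> letters A" for u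
        unfolding C_def by (rule rcosetsI[OF Hsub reduce_in_carrier[OF that]])
      then show "id ` verts \<Delta> \<subseteq> rcosets\<^bsub>?F\<^esub> H"
        using C_Nil[symmetric] E by (auto simp: \<Delta>_def V_def)
    qed (use step_C in simp)
    from loop_in_subgroup[OF this H lab, of H] show "?L \<subseteq> H"
      by (auto simp: carrier_free_group) (metis reduce_reduced)
    have "S \<subseteq> ?L"
      using path_prefix[of _ "[]"] C_S S(1) by fastforce
    then have "generate ?F S \<subseteq> ?L"
      by (rule generate_subgroup_incl[OF _ stallingsD(9)[OF st]])
    then show "H \<subseteq> ?L"
      by (rule ord_eq_le_trans[OF S(3)])
  qed
  with st have st: "stallings A \<Delta> H H" by simp
  obtain f :: "'a word set \<Rightarrow> nat" where "inj_on f (verts \<Delta>)"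
    using finite_imp_inj_to_nat_seg[OF fin(1)] by blast
  from that[OF stallings_map_inj[OF st this]] show ?thesis .
qed

section \<open>Existence of the sequence, its stabilization and its limit\<close>

theorem theorem3p3:
  fixes A :: "'a set" and H :: "'a word set"
  assumes "finite A"
    and "subgroup H (free_group A)"
    and "finitely_generated (free_group A) H"
    and "H \<noteq> {\<one>\<^bsub>free_group A\<^esub>}"
  shows "(\<exists>Hs \<Gamma> b. construction_sequence A H Hs \<Gamma> b) \<and>
    (\<forall>Hs \<Gamma> b. construction_sequence A H Hs \<Gamma> b \<longrightarrow>
      (\<exists>k. infinite_pairs (\<Gamma> k) (b k) = {} \<and>
           (\<forall>i\<ge>k. Hs i = Hs k) \<and>
           is_malnormal_closure (free_group A) H (Hs k)))"
proof (intro conjI allI impI)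
  obtain \<Gamma>0 :: "(nat, 'a) lgraph" and b0 where 0: "stallings A \<Gamma>0 b0 H"
    by (rule stallings_exists[OF assms(1,3)])
  \<comment> \<open>Dependent choice over triples of subgroup, graph and base vertex;
    \<open>P\<close> ties the subgroup to \<open>H\<close> at index 0 only.\<close>
  define P :: "nat \<Rightarrow> 'a word set \<times> (nat, 'a) lgraph \<times> nat \<Rightarrow> bool"
    where "P n = (\<lambda>(K, \<Gamma>, b). stallings A \<Gamma> b K \<and> (n = 0 \<longrightarrow> K = H))" for n
  define Q :: "nat \<Rightarrow> 'a word set \<times> (nat, 'a) lgraph \<times> nat \<Rightarrow> 'a word set \<times> (nat, 'a) lgraph \<times> nat \<Rightarrow> bool"
    where "Q n = (\<lambda>(K, \<Gamma>, b) (K', \<Gamma>', b'). construction \<Gamma> b \<Gamma>' b')" for n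
  have "\<exists>X. \<forall>n. P n (X n) \<and> Q n (X n) (X (Suc n))"
  proof (rule dependent_nat_choice)
    show "\<exists>x. P 0 x" using 0 by (intro exI[of _ "(H, \<Gamma>0, b0)"]) (simp add: P_def)
    fix x n assume "P n x"
    then obtain K \<Gamma> b where x: "x = (K, \<Gamma>, b)" "stallings A \<Gamma> b K"
      by (cases x) (auto simp: P_def)
    obtain \<Gamma>' b' K' where "construction \<Gamma> b \<Gamma>' b'" "stallings A \<Gamma>' b' K'"
      by (rule construction_exists[OF x(2)])
    then show "\<exists>y. P (Suc n) y \<and> Q n x y"
      by (intro exI[of _ "(K', \<Gamma>', b')"]) (simp add: P_def Q_def x)
  qed
  then obtain X where X: "\<And>n. P n (X n)" "\<And>n. Q n (X n) (X (Suc n))" by blast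
  have "construction_sequence A H (\<lambda>n. fst (X n)) (\<lambda>n. fst (snd (X n))) (\<lambda>n. snd (snd (X n)))"
    unfolding construction_sequence_def
    using X by (auto simp: P_def Q_def case_prod_beta')
  then show "\<exists>Hs \<Gamma> b. construction_sequence A H Hs \<Gamma> b" by blast
next
  fix Hs :: "nat \<Rightarrow> 'a word set" and \<Gamma> :: "nat \<Rightarrow> (nat, 'a) lgraph" and b
  assume seq: "construction_sequence A H Hs \<Gamma> b"
  have H0: "Hs 0 = H" and st: "stallings A (\<Gamma> i) (b i) (Hs i)"
    and con: "construction (\<Gamma> i) (b i) (\<Gamma> (Suc i)) (b (Suc i))" for i
    using seq by (simp_all add: construction_sequence_def)
  let ?c = "\<lambda>i. card (verts (\<Gamma> i))"
  have dec: "?c (Suc i) \<le> ?c i" for i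
    by (rule construction_card(1)[OF st st con])
  \<comment> \<open>The vertex counts are non-increasing, so from an index with the least count on
    they are constant, and no later step merges any vertices.\<close>
  obtain k where k: "\<And>i. ?c k \<le> ?c i"
    using ex_has_least_nat[of "\<lambda>_. True" 0 ?c] by auto
  have const: "?c i = ?c k" if "k \<le> i" for i
    using lift_Suc_antimono_le[of ?c, OF dec that] k[of i] by simp
  have stop: "infinite_pairs (\<Gamma> i) (b i) = {} \<and> Hs (Suc i) = Hs i" if "k \<le> i" for i
    using construction_card(2)[OF st st con, of i] const[OF that] const[of "Suc i"] that by simp
  have "Hs i = Hs k" if "k \<le> i" for i
    using that by (induction rule: dec_induct) (use stop in auto)
  moreover have "is_malnormal_closure (free_group A) H (Hs k)"
    unfolding is_malnormal_closure_def
  proof (intro conjI allI impI)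
    show "malnormal (free_group A) (Hs k)"
      using malnormal_if_no_infinite_pairs[OF st] stop by blast
    have "H \<subseteq> Hs i" for i
      by (induction i) (use H0 construction_subset[OF st st con] in auto)
    then show "H \<subseteq> Hs k" .
    fix K assume K: "malnormal (free_group A) K \<and> H \<subseteq> K"
    have "Hs i \<subseteq> K" for i
    proof (induction i)
      case 0
      then show ?case using K H0 by simp
    next
      case (Suc i)
      then show ?case using construction_subset_malnormal[OF st st con assms(1)] K by blast
    qed
    then show "Hs k \<subseteq> K" .
  qed
  ultimately show "\<exists>k. infinite_pairs (\<Gamma> k) (b k) = {} \<and> (\<forall>i\<ge>k. Hs i = Hs k) \<and>
      is_malnormal_closure (free_group A) H (Hs k)"
    using stop[OF order_refl] by blast
qed

end
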